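(* Let $K$ be a commutative $\mathbb Q$-algebra, $n\ge1$, and let $F=X-H$ be a polynomial map over $K$ in $n$ variables, where $H=(H_1,\ldots,H_n)$ is homogeneous of degree $d\ge 2$, the Jacobian matrix $JH$ is symmetric, and $(JH)^3=0$. Then $F$ is invertible, with $$F^{-1}=X+N^{(1)}+N^{(2)}.$$ In particular, the degree of $F^{-1}$ is $\le 2d-1$ (independent of $n$).
   Context: $X=(X_1,\ldots,X_n)$, and $JH=(D_iH_j)$ with $D_i=\partial/\partial X_i$. "$H$ homogeneous of degree $d$" means each $H_i\in K[X_1,\ldots,X_n]$ is homogeneous of degree $d$ (possibly zero). "Invertible" means that $F$ has an inverse under composition which is a polynomial map over $K$. Such an $F=X-H$ always has a unique formal inverse $G$ (a system of power series $G_i=X_i+\text{higher degree terms}$ with $F\circ G=G\circ F=X$), and it has the form $G=X+N^{(1)}+N^{(2)}+N^{(3)}+\cdots$ with $N^{(m)}$ (an $n$-tuple) homogeneous of degree $m(d-1)+1$; this defines the $N^{(m)}$. *)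

theory Defs
  imports "HOL-Analysis.Analysis" "HOL-Library.Poly_Mapping"
begin

section \<open>Commutative algebras over the rationals\<close>

text \<open>A \<open>\<rat>\<close>-algebra is given by its structure map, a unital ring homomorphism from \<open>\<rat>\<close>.\<close>

definition rat_algebra :: "(rat \<Rightarrow> 'k::comm_ring_1) \<Rightarrow> bool" where
  "rat_algebra \<phi> \<longleftrightarrow> \<phi> 1 = 1 \<and> (\<forall>x y. \<phi> (x + y) = \<phi> x + \<phi> y) \<and> (\<forall>x y. \<phi> (x * y) = \<phi> x * \<phi> y)"


section \<open>Polynomials and polynomial maps\<close>

text \<open>
  The variables are indexed by a type \<open>'n\<close>, so that \<open>n\<close> is its (finite, nonzero) cardinality.
  A monomial is its exponent vector \<open>'n \<Rightarrow>\<^sub>0 nat\<close>, and the ring structure on \<open>('n, 'k) mpoly\<close> is the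
  convolution product of \<^theory>\<open>HOL-Library.Poly_Mapping\<close>.
\<close>

type_synonym ('n, 'k) mpoly = "('n \<Rightarrow>\<^sub>0 nat) \<Rightarrow>\<^sub>0 'k"

type_synonym ('n, 'k) polymap = "('n, 'k) mpoly ^ 'n"

definition mdeg :: "('n::finite \<Rightarrow>\<^sub>0 nat) \<Rightarrow> nat" where
  "mdeg \<alpha> = (\<Sum>i\<in>UNIV. Poly_Mapping.lookup \<alpha> i)"

definition const :: "'k \<Rightarrow> ('n, 'k::comm_ring_1) mpoly" where
  "const c = Poly_Mapping.single 0 c"

definition var :: "'n \<Rightarrow> ('n, 'k::comm_ring_1) mpoly" where
  "var i = Poly_Mapping.single (Poly_Mapping.single i 1) 1"

definition homogeneous :: "nat \<Rightarrow> ('n::finite, 'k::comm_ring_1) mpoly \<Rightarrow> bool" where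
  "homogeneous d p \<longleftrightarrow> (\<forall>\<alpha>\<in>Poly_Mapping.keys p. mdeg \<alpha> = d)"

text \<open>The zero polynomial gets degree \<open>0\<close>.\<close>

definition tdeg :: "('n::finite, 'k::comm_ring_1) mpoly \<Rightarrow> nat" where
  "tdeg p = Max (insert 0 (mdeg ` Poly_Mapping.keys p))"

definition polymap_degree :: "('n::finite, 'k::comm_ring_1) polymap \<Rightarrow> nat" where
  "polymap_degree F = Max (range (\<lambda>i. tdeg (F $ i)))"

text \<open>
  Partial derivatives. Subtraction of exponents truncates, but if \<open>\<alpha>\<^sub>i = 0\<close> the coefficient
  vanishes.
\<close>

definition partial :: "'n \<Rightarrow> ('n, 'k::comm_ring_1) mpoly \<Rightarrow> ('n, 'k) mpoly" where
  "partial i p = (\<Sum>\<alpha>\<in>Poly_Mapping.keys p.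
     Poly_Mapping.single (\<alpha> - Poly_Mapping.single i 1)
       (of_nat (Poly_Mapping.lookup \<alpha> i) * Poly_Mapping.lookup p \<alpha>))"

definition jacobian_matrix :: "('n::finite, 'k::comm_ring_1) polymap \<Rightarrow> ('n, 'k) mpoly ^ 'n ^ 'n" where
  "jacobian_matrix H = (\<chi> i j. partial j (H $ i))"

definition subst :: "('n::finite, 'k::comm_ring_1) mpoly \<Rightarrow> ('n, 'k) polymap \<Rightarrow> ('n, 'k) mpoly" where
  "subst p G = (\<Sum>\<alpha>\<in>Poly_Mapping.keys p.
     const (Poly_Mapping.lookup p \<alpha>) * (\<Prod>i\<in>UNIV. (G $ i) ^ Poly_Mapping.lookup \<alpha> i))"

definition polymap_compose ::
    "('n::finite, 'k::comm_ring_1) polymap \<Rightarrow> ('n, 'k) polymap \<Rightarrow> ('n, 'k) polymap" where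
  "polymap_compose F G = (\<chi> i. subst (F $ i) G)"

definition polymap_id :: "('n::finite, 'k::comm_ring_1) polymap" where
  "polymap_id = (\<chi> i. var i)"

definition is_polymap_inverse ::
    "('n::finite, 'k::comm_ring_1) polymap \<Rightarrow> ('n, 'k) polymap \<Rightarrow> bool" where
  "is_polymap_inverse F G \<longleftrightarrow>
     polymap_compose F G = polymap_id \<and> polymap_compose G F = polymap_id"

definition polymap_invertible :: "('n::finite, 'k::comm_ring_1) polymap \<Rightarrow> bool" where
  "polymap_invertible F \<longleftrightarrow> (\<exists>G. is_polymap_inverse F G)"

definition polymap_inverse :: "('n::finite, 'k::comm_ring_1) polymap \<Rightarrow> ('n, 'k) polymap" where
  "polymap_inverse F = (THE G. is_polymap_inverse F G)"


section \<open>Formal power series in several variables\<close>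

typedef ('n, 'k) mps = "UNIV :: (('n \<Rightarrow>\<^sub>0 nat) \<Rightarrow> 'k) set"
  morphisms mps_coeff Abs_mps
  by simp

lemma mps_coeff_Abs [simp]: "mps_coeff (Abs_mps f) = f"
  by (simp add: Abs_mps_inverse)

lemma mps_eqI: "(\<And>\<alpha>. mps_coeff f \<alpha> = mps_coeff g \<alpha>) \<Longrightarrow> f = g"
  by (metis mps_coeff_inject ext)

definition splits :: "('n::finite \<Rightarrow>\<^sub>0 nat) \<Rightarrow> (('n \<Rightarrow>\<^sub>0 nat) \<times> ('n \<Rightarrow>\<^sub>0 nat)) set" where
  "splits \<alpha> = {(\<beta>, \<gamma>). \<beta> + \<gamma> = \<alpha>}"

lemma finite_bounded_exponents:
  "finite {\<beta>::'n::finite \<Rightarrow>\<^sub>0 nat. \<forall>i. Poly_Mapping.lookup \<beta> i \<le> N}"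
proof (rule finite_imageD)
  show "finite (Poly_Mapping.lookup ` {\<beta>::'n \<Rightarrow>\<^sub>0 nat. \<forall>i. Poly_Mapping.lookup \<beta> i \<le> N})"
    by (rule finite_subset[OF _ finite_PiE[of UNIV "\<lambda>_::'n. {..N}"]]) auto
  show "inj_on Poly_Mapping.lookup {\<beta>::'n \<Rightarrow>\<^sub>0 nat. \<forall>i. Poly_Mapping.lookup \<beta> i \<le> N}"
    by (rule inj_onI) (simp add: Poly_Mapping.lookup_inject)
qed

lemma lookup_le_mdeg: "Poly_Mapping.lookup \<alpha> i \<le> mdeg \<alpha>"
  unfolding mdeg_def by (rule member_le_sum) auto

lemma mdeg_add: "mdeg (\<alpha> + \<beta>) = mdeg \<alpha> + mdeg \<beta>"
  by (simp add: mdeg_def lookup_add sum.distrib)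

lemma finite_mdeg_le: "finite {\<beta>::'n::finite \<Rightarrow>\<^sub>0 nat. mdeg \<beta> \<le> k}"
  by (rule finite_subset[OF _ finite_bounded_exponents[of k]])
     (auto intro: order_trans[OF lookup_le_mdeg])

lemma finite_splits [simp]: "finite (splits \<alpha>)"
  by (rule finite_subset[OF _ finite_cartesian_product[OF finite_mdeg_le finite_mdeg_le,
        of "mdeg \<alpha>" "mdeg \<alpha>"]])
     (auto simp: splits_def mdeg_add)

instantiation mps :: (finite, comm_ring_1) comm_ring_1
begin

definition "0 = Abs_mps (\<lambda>_. 0)"
definition "1 = Abs_mps (\<lambda>\<alpha>. if \<alpha> = 0 then 1 else 0)"
definition "f + g = Abs_mps (\<lambda>\<alpha>. mps_coeff f \<alpha> + mps_coeff g \<alpha>)"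
definition "f - g = Abs_mps (\<lambda>\<alpha>. mps_coeff f \<alpha> - mps_coeff g \<alpha>)"
definition "- f = Abs_mps (\<lambda>\<alpha>. - mps_coeff f \<alpha>)"
definition "f * g = Abs_mps (\<lambda>\<alpha>. \<Sum>(\<beta>, \<gamma>)\<in>splits \<alpha>. mps_coeff f \<beta> * mps_coeff g \<gamma>)"

instance
proof
  fix f g h :: "('a, 'b) mps"
  show "f * g * h = f * (g * h)"
  proof (rule mps_eqI)
    fix \<alpha>
    let ?f = "mps_coeff f" and ?g = "mps_coeff g" and ?h = "mps_coeff h"
    have "mps_coeff (f * g * h) \<alpha> =
        (\<Sum>x\<in>splits \<alpha>. \<Sum>y\<in>splits (fst x). ?f (fst y) * ?g (snd y) * ?h (snd x))"
      by (simp add: times_mps_def sum_distrib_right case_prod_beta)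
    also have "\<dots> = (\<Sum>(x, y)\<in>Sigma (splits \<alpha>) (\<lambda>x. splits (fst x)).
        ?f (fst y) * ?g (snd y) * ?h (snd x))"
      by (rule sum.Sigma) auto
    also have "\<dots> = (\<Sum>(x, y)\<in>Sigma (splits \<alpha>) (\<lambda>x. splits (snd x)).
        ?f (fst x) * (?g (fst y) * ?h (snd y)))"
      by (rule sum.reindex_bij_witness[where
            i = "\<lambda>((\<delta>, \<rho>), (\<epsilon>, \<gamma>)). ((\<delta> + \<epsilon>, \<gamma>), (\<delta>, \<epsilon>))" and
            j = "\<lambda>((\<beta>, \<gamma>), (\<delta>, \<epsilon>)). ((\<delta>, \<epsilon> + \<gamma>), (\<epsilon>, \<gamma>))"])
         (auto simp: splits_def add.assoc mult.assoc)
    also have "\<dots> = (\<Sum>x\<in>splits \<alpha>. \<Sum>y\<in>splits (snd x). ?f (fst x) * (?g (fst y) * ?h (snd y)))"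
      by (rule sum.Sigma[symmetric]) auto
    also have "\<dots> = mps_coeff (f * (g * h)) \<alpha>"
      by (simp add: times_mps_def sum_distrib_left case_prod_beta)
    finally show "mps_coeff (f * g * h) \<alpha> = mps_coeff (f * (g * h)) \<alpha>" .
  qed
  show "f * g = g * f"
  proof (rule mps_eqI)
    fix \<alpha>
    have "(\<Sum>(\<beta>, \<gamma>)\<in>splits \<alpha>. mps_coeff f \<beta> * mps_coeff g \<gamma>) =
        (\<Sum>(\<beta>, \<gamma>)\<in>splits \<alpha>. mps_coeff g \<beta> * mps_coeff f \<gamma>)"
      by (rule sum.reindex_bij_witness[where i = prod.swap and j = prod.swap])
         (auto simp: splits_def add.commute mult.commute)
    then show "mps_coeff (f * g) \<alpha> = mps_coeff (g * f) \<alpha>"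
      by (simp add: times_mps_def)
  qed
  show "1 * f = f"
  proof (rule mps_eqI)
    fix \<alpha>
    have "(\<Sum>(\<beta>, \<gamma>)\<in>splits \<alpha>. (if \<beta> = 0 then 1 else 0) * mps_coeff f \<gamma>) =
        (\<Sum>(\<beta>, \<gamma>)\<in>{(0::'a \<Rightarrow>\<^sub>0 nat, \<alpha>)}. (if \<beta> = 0 then 1 else 0) * mps_coeff f \<gamma>)"
      by (rule sum.mono_neutral_right[OF finite_splits]) (auto simp: splits_def split: if_splits)
    then show "mps_coeff (1 * f) \<alpha> = mps_coeff f \<alpha>"
      by (simp add: times_mps_def one_mps_def)
  qed
  show "(f + g) * h = f * h + g * h"
    by (rule mps_eqI)
       (simp add: times_mps_def plus_mps_def distrib_right case_prod_beta sum.distrib)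
  show "(0::('a, 'b) mps) \<noteq> 1"
  proof
    assume "(0::('a, 'b) mps) = 1"
    then have "mps_coeff (0::('a, 'b) mps) 0 = mps_coeff 1 0" by simp
    then show False by (simp add: zero_mps_def one_mps_def)
  qed
  show "f + g + h = f + (g + h)"
    by (simp add: plus_mps_def add.assoc)
  show "f + g = g + f"
    by (simp add: plus_mps_def add.commute)
  show "0 + f = f"
    by (rule mps_eqI) (simp add: zero_mps_def plus_mps_def)
  show "- f + f = 0"
    by (simp add: zero_mps_def plus_mps_def uminus_mps_def)
  show "f - g = f + - g"
    by (simp add: minus_mps_def plus_mps_def uminus_mps_def)
qed

end

definition mps_of_poly :: "('n::finite, 'k::comm_ring_1) mpoly \<Rightarrow> ('n, 'k) mps" where
  "mps_of_poly p = Abs_mps (Poly_Mapping.lookup p)"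

text \<open>
  Substitution \<open>f(g\<^sub>1, \<dots>, g\<^sub>n) = \<Sum>\<^sub>\<beta> f\<^sub>\<beta> g\<^sup>\<beta>\<close>. It is meaningful only when all \<open>g\<^sub>i\<close> have zero
  constant term; then \<open>g\<^sup>\<beta>\<close> has order at least \<open>|\<beta>|\<close>, so that only the finitely many \<open>\<beta>\<close> with
  \<open>|\<beta>| \<le> |\<alpha>|\<close> contribute to the coefficient at \<open>\<alpha>\<close>.
\<close>

definition mps_subst ::
    "('n::finite, 'k::comm_ring_1) mps \<Rightarrow> ('n, 'k) mps ^ 'n \<Rightarrow> ('n, 'k) mps" where
  "mps_subst f g = Abs_mps (\<lambda>\<alpha>. \<Sum>\<beta> | mdeg \<beta> \<le> mdeg \<alpha>.
     mps_coeff f \<beta> * mps_coeff (\<Prod>i\<in>UNIV. (g $ i) ^ Poly_Mapping.lookup \<beta> i) \<alpha>)"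

definition mpsmap_compose ::
    "('n::finite, 'k::comm_ring_1) mps ^ 'n \<Rightarrow> ('n, 'k) mps ^ 'n \<Rightarrow> ('n, 'k) mps ^ 'n" where
  "mpsmap_compose F G = (\<chi> i. mps_subst (F $ i) G)"

definition mpsmap_of_polymap :: "('n::finite, 'k::comm_ring_1) polymap \<Rightarrow> ('n, 'k) mps ^ 'n" where
  "mpsmap_of_polymap F = (\<chi> i. mps_of_poly (F $ i))"


section \<open>The formal inverse\<close>

text \<open>
  The first conjunct says \<open>G\<^sub>i = X\<^sub>i + higher degree terms\<close>. The definition is used for polynomial
  maps \<open>F = X - H\<close> with \<open>H\<close> homogeneous of degree at least \<open>2\<close>, which have zero constant term.
\<close>

definition is_formal_inverse ::
    "('n::finite, 'k::comm_ring_1) polymap \<Rightarrow> ('n, 'k) mps ^ 'n \<Rightarrow> bool" where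
  "is_formal_inverse F G \<longleftrightarrow>
     (\<forall>i \<alpha>. mdeg \<alpha> \<le> 1 \<longrightarrow> mps_coeff (G $ i) \<alpha> = Poly_Mapping.lookup (var i) \<alpha>) \<and>
     mpsmap_compose (mpsmap_of_polymap F) G = mpsmap_of_polymap polymap_id \<and>
     mpsmap_compose G (mpsmap_of_polymap F) = mpsmap_of_polymap polymap_id"

definition formal_inverse ::
    "('n::finite, 'k::comm_ring_1) polymap \<Rightarrow> ('n, 'k) mps ^ 'n" where
  "formal_inverse F = (THE G. is_formal_inverse F G)"

definition hom_part :: "nat \<Rightarrow> ('n::finite, 'k::comm_ring_1) mps \<Rightarrow> ('n, 'k) mpoly" where
  "hom_part k f = (\<Sum>\<alpha> | mdeg \<alpha> = k. Poly_Mapping.single \<alpha> (mps_coeff f \<alpha>))"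

text \<open>
  The term \<open>N\<^sup>(\<^sup>m\<^sup>)\<close> in the expansion \<open>X + N\<^sup>(\<^sup>1\<^sup>) + N\<^sup>(\<^sup>2\<^sup>) + \<dots>\<close> of the formal inverse of \<open>X - H\<close>, where \<open>H\<close>
  is homogeneous of degree \<open>d\<close>.
\<close>

definition inverse_term ::
    "nat \<Rightarrow> ('n::finite, 'k::comm_ring_1) polymap \<Rightarrow> nat \<Rightarrow> ('n, 'k) polymap" where
  "inverse_term d H m = (\<chi> i. hom_part (m * (d - 1) + 1) (formal_inverse (polymap_id - H) $ i))"

end

theory Submission
  imports Defs
begin

text \<open>
  Put \<open>N = JH \<cdot> H\<close> and \<open>U = H + N\<close>. Symmetry together with \<open>(JH)\<^sup>3 = 0\<close> and Euler's identity
  \<open>JH \<cdot> X = d H\<close> gives \<open>JH \<cdot> N = JN \<cdot> H = JN \<cdot> N = 0\<close>, which amounts to a Burgers equation for \<open>U\<close>.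
  It implies that the errors \<open>E = H(X + U) - U\<close> and \<open>E' = U(X - H) - H\<close> satisfy
  \<open>JE \<cdot> X - d E = (d - 1) JE \<cdot> U\<close> and \<open>JE' \<cdot> X - d E' = (d - 1) JU(X - H) \<cdot> E'\<close>. Both errors have only
  terms of degree above \<open>d\<close>, and comparing the terms of lowest degree shows that they vanish. Hence
  \<open>X + U\<close> is the inverse of \<open>X - H\<close>. It is also the formal inverse, which is unique as a fixed point
  of \<open>G \<mapsto> X + H(G)\<close>.
\<close>


section \<open>Polynomials\<close>

lemma mdeg_single [simp]: "mdeg (Poly_Mapping.single i m) = m"
  by (simp add: mdeg_def lookup_single when_def)

lemma mpoly_sum_singles:
  fixes p :: "('n, 'k::comm_ring_1) mpoly"
  shows "p = (\<Sum>\<alpha>\<in>Poly_Mapping.keys p. Poly_Mapping.single \<alpha> (Poly_Mapping.lookup p \<alpha>))"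
proof (rule poly_mapping_eqI)
  fix \<beta>
  have "(\<Sum>\<alpha>\<in>Poly_Mapping.keys p. Poly_Mapping.lookup p \<alpha> when \<alpha> = \<beta>) = Poly_Mapping.lookup p \<beta>"
    by (cases "\<beta> \<in> Poly_Mapping.keys p")
       (auto simp: when_def sum.delta in_keys_iff)
  then show "Poly_Mapping.lookup p \<beta> =
      Poly_Mapping.lookup (\<Sum>\<alpha>\<in>Poly_Mapping.keys p. Poly_Mapping.single \<alpha> (Poly_Mapping.lookup p \<alpha>)) \<beta>"
    by (simp add: lookup_sum lookup_single)
qed

text \<open>Zero needs no case of its own, being a monomial with coefficient 0. The rule serves
  statements that are additive in the polynomial.\<close>

lemma mpoly_single_induct [case_names single add]:
  fixes p :: "('n, 'k::comm_ring_1) mpoly"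
  assumes single: "\<And>\<alpha> c. P (Poly_Mapping.single \<alpha> c)"
    and add: "\<And>p q. P p \<Longrightarrow> P q \<Longrightarrow> P (p + q)"
  shows "P p"
proof -
  have "P (0 :: ('n, 'k) mpoly)"
    using single[of 0 0] by simp
  then have "P (\<Sum>\<alpha>\<in>A. Poly_Mapping.single \<alpha> (Poly_Mapping.lookup p \<alpha>))" for A
    by (induction A rule: infinite_finite_induct) (auto intro: single add)
  then show ?thesis
    using mpoly_sum_singles[of p] by metis
qed

lemma const_add: "const (a + b) = const a + const b"
  by (simp add: const_def single_add)

lemma const_mult: "const (a * b) = const a * const b"
  by (simp add: const_def mult_single)

lemma const_1 [simp]: "const 1 = 1"
  by (simp add: const_def)

lemma const_0 [simp]: "const 0 = 0"
  by (simp add: const_def)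

lemma var_power: "var i ^ k = Poly_Mapping.single (Poly_Mapping.single i k) 1"
  by (induction k) (simp_all add: var_def mult_single single_add[symmetric])

lemma exponent_sum_singles:
  fixes \<alpha> :: "'n::finite \<Rightarrow>\<^sub>0 nat"
  shows "(\<Sum>i\<in>UNIV. Poly_Mapping.single i (Poly_Mapping.lookup \<alpha> i)) = \<alpha>"
  by (rule poly_mapping_eqI) (simp add: lookup_sum lookup_single when_def)

lemma prod_var_power:
  fixes \<alpha> :: "'n::finite \<Rightarrow>\<^sub>0 nat"
  shows "(\<Prod>i\<in>UNIV. var i ^ Poly_Mapping.lookup \<alpha> i) =
    (Poly_Mapping.single \<alpha> 1 :: ('n, 'k::comm_ring_1) mpoly)"
proof -
  have "(\<Prod>i\<in>A. Poly_Mapping.single (f i) (1::'k)) = Poly_Mapping.single (\<Sum>i\<in>A. f i) 1"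
    if "finite A" for A :: "'n set" and f :: "'n \<Rightarrow> 'n \<Rightarrow>\<^sub>0 nat"
    using that by (induction A) (simp_all add: mult_single)
  then show ?thesis
    by (simp add: var_power exponent_sum_singles)
qed

lemma single_eq_const_prod_var:
  fixes \<alpha> :: "'n::finite \<Rightarrow>\<^sub>0 nat"
  shows "Poly_Mapping.single \<alpha> c = const c * (\<Prod>i\<in>UNIV. var i ^ Poly_Mapping.lookup \<alpha> i)"
  by (simp add: prod_var_power const_def mult_single)

text \<open>Constants and variables generate the polynomial ring. The rule serves to compare ring
  homomorphisms or derivations.\<close>

lemma mpoly_induct [case_names const var add mult]:
  fixes p :: "('n::finite, 'k::comm_ring_1) mpoly"
  assumes const: "\<And>c. P (const c)" and var: "\<And>i. P (var i)"
    and add: "\<And>p q. P p \<Longrightarrow> P q \<Longrightarrow> P (p + q)"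
    and mult: "\<And>p q. P p \<Longrightarrow> P q \<Longrightarrow> P (p * q)"
  shows "P p"
proof (induction p rule: mpoly_single_induct)
  case (single \<alpha> c)
  have 1: "P 1"
    using const[of 1] by simp
  have "P (var i ^ k)" for i k
    by (induction k) (auto intro: 1 mult var)
  then have "P (\<Prod>i\<in>A. var i ^ Poly_Mapping.lookup \<alpha> i)" for A
    by (induction A rule: infinite_finite_induct) (auto intro: 1 mult)
  then show ?case
    by (auto simp: single_eq_const_prod_var intro: mult const)
qed (rule add)

lemma lookup_of_nat_mult:
  fixes p :: "('n, 'k::comm_ring_1) mpoly"
  shows "Poly_Mapping.lookup (of_nat m * p) \<alpha> = of_nat m * Poly_Mapping.lookup p \<alpha>"
  by (induction m) (simp_all add: distrib_right lookup_add)

text \<open>\<open>\<phi> (1 / of_nat m)\<close> is an inverse of \<open>of_nat m\<close>. The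
  rational structure enters the whole proof through this cancellation.\<close>

lemma rat_algebra_of_nat_mult_eq_0:
  fixes \<phi> :: "rat \<Rightarrow> 'k::comm_ring_1" and x :: 'k
  assumes "rat_algebra \<phi>" "m > 0" "of_nat m * x = 0"
  shows "x = 0"
proof -
  have hom: "\<phi> 1 = 1" "\<And>x y. \<phi> (x + y) = \<phi> x + \<phi> y" "\<And>x y. \<phi> (x * y) = \<phi> x * \<phi> y"
    using assms(1) by (auto simp: rat_algebra_def)
  have "\<phi> 0 = 0"
    using hom(2)[of 0 0] by simp
  then have "\<phi> (of_nat k) = of_nat k" for k
    by (induction k) (simp_all add: hom)
  then have "\<phi> (1 / of_nat m) * of_nat m = 1"
    using hom(3)[of "1 / of_nat m" "of_nat m"] hom(1) assms(2) by simp
  then have "x = \<phi> (1 / of_nat m) * (of_nat m * x)"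
    by (simp flip: mult.assoc)
  then show ?thesis
    by (simp add: assms(3))
qed

lemma rat_algebra_mpoly_of_nat_mult_eq_0:
  fixes \<phi> :: "rat \<Rightarrow> 'k::comm_ring_1" and p :: "('n, 'k) mpoly"
  assumes "rat_algebra \<phi>" "m > 0" "of_nat m * p = 0"
  shows "p = 0"
proof (rule poly_mapping_eqI)
  fix \<alpha>
  have "of_nat m * Poly_Mapping.lookup p \<alpha> = 0"
    using assms(3) lookup_of_nat_mult[of m p \<alpha>] by simp
  then show "Poly_Mapping.lookup p \<alpha> = Poly_Mapping.lookup 0 \<alpha>"
    using rat_algebra_of_nat_mult_eq_0[OF assms(1,2)] by simp
qed

lemma rat_algebra_polymap_scalar_eq_0:
  fixes \<phi> :: "rat \<Rightarrow> 'k::comm_ring_1" and P :: "('n::finite, 'k) polymap"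
  assumes "rat_algebra \<phi>" "m > 0" "of_nat m *s P = 0"
  shows "P = 0"
proof -
  have "P $ i = 0" for i
  proof (rule rat_algebra_mpoly_of_nat_mult_eq_0[OF assms(1,2)])
    show "of_nat m * P $ i = 0"
      using arg_cong[OF assms(3), of "\<lambda>v. v $ i"] by simp
  qed
  then show ?thesis
    by (simp add: vec_eq_iff)
qed


section \<open>Partial derivatives\<close>

lemma exponent_eq_minus_single_iff:
  fixes \<alpha> \<beta> :: "'n \<Rightarrow>\<^sub>0 nat"
  assumes "Poly_Mapping.lookup \<beta> i \<noteq> 0"
  shows "\<beta> - Poly_Mapping.single i 1 = \<alpha> \<longleftrightarrow> \<beta> = \<alpha> + Poly_Mapping.single i 1"
proof -
  have "\<beta> - Poly_Mapping.single i 1 + Poly_Mapping.single i 1 = \<beta>"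
    by (rule poly_mapping_eqI)
       (use assms in \<open>auto simp: lookup_add lookup_minus lookup_single when_def\<close>)
  then show ?thesis
    by (metis add_diff_cancel_right')
qed

text \<open>The sum defining \<open>partial\<close> runs over a support that depends on
  \<open>p\<close>. This formula is visibly linear in \<open>p\<close>, so that additivity and
  commuting derivatives become coefficientwise checks.\<close>

lemma lookup_partial:
  fixes p :: "('n, 'k::comm_ring_1) mpoly"
  shows "Poly_Mapping.lookup (partial i p) \<alpha> =
    of_nat (Poly_Mapping.lookup \<alpha> i + 1) * Poly_Mapping.lookup p (\<alpha> + Poly_Mapping.single i 1)"
proof -
  let ?\<beta> = "\<alpha> + Poly_Mapping.single i 1"
  have "Poly_Mapping.lookup (partial i p) \<alpha> = (\<Sum>\<beta>\<in>Poly_Mapping.keys p.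
      of_nat (Poly_Mapping.lookup \<beta> i) * Poly_Mapping.lookup p \<beta>
        when \<beta> - Poly_Mapping.single i 1 = \<alpha>)"
    by (simp add: partial_def lookup_sum lookup_single)
  also have "\<dots> = (\<Sum>\<beta>\<in>Poly_Mapping.keys p.
      if \<beta> = ?\<beta> then of_nat (Poly_Mapping.lookup \<beta> i) * Poly_Mapping.lookup p \<beta> else 0)"
  proof (rule sum.cong[OF refl])
    fix \<beta>
    show "(of_nat (Poly_Mapping.lookup \<beta> i) * Poly_Mapping.lookup p \<beta>
          when \<beta> - Poly_Mapping.single i 1 = \<alpha>) =
        (if \<beta> = ?\<beta> then of_nat (Poly_Mapping.lookup \<beta> i) * Poly_Mapping.lookup p \<beta> else 0)"
      using exponent_eq_minus_single_iff[of \<beta> i \<alpha>]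
      by (cases "Poly_Mapping.lookup \<beta> i = 0") (auto simp: when_def lookup_add)
  qed
  also have "\<dots> = of_nat (Poly_Mapping.lookup ?\<beta> i) * Poly_Mapping.lookup p ?\<beta>"
    by (simp add: sum.delta in_keys_iff)
  finally show ?thesis
    by (simp add: lookup_add)
qed

lemma partial_add: "partial i (p + q) = partial i p + partial i q"
  by (rule poly_mapping_eqI) (simp add: lookup_partial lookup_add distrib_left)

lemma partial_diff: "partial i (p - q) = partial i p - partial i q"
  by (rule poly_mapping_eqI) (simp add: lookup_partial lookup_minus right_diff_distrib)

lemma partial_0 [simp]: "partial i 0 = 0"
  by (rule poly_mapping_eqI) (simp add: lookup_partial)

lemma partial_sum: "partial i (sum f A) = (\<Sum>a\<in>A. partial i (f a))"
  by (induction A rule: infinite_finite_induct) (simp_all add: partial_add)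

lemma partial_single:
  fixes c :: "'k::comm_ring_1"
  shows "partial i (Poly_Mapping.single \<alpha> c) =
    Poly_Mapping.single (\<alpha> - Poly_Mapping.single i 1) (of_nat (Poly_Mapping.lookup \<alpha> i) * c)"
  by (cases "c = 0") (simp_all add: partial_def)

lemma partial_commute: "partial i (partial j p) = partial j (partial i p)"
proof (rule poly_mapping_eqI)
  fix \<alpha>
  have "\<alpha> + Poly_Mapping.single i 1 + Poly_Mapping.single j 1 =
      \<alpha> + Poly_Mapping.single j 1 + Poly_Mapping.single i (1::nat)"
    by (simp add: ac_simps)
  then show "Poly_Mapping.lookup (partial i (partial j p)) \<alpha> =
      Poly_Mapping.lookup (partial j (partial i p)) \<alpha>"
    by (cases "i = j") (simp_all add: lookup_partial lookup_add lookup_single when_def mult_ac)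
qed

lemma partial_const [simp]: "partial i (const c) = 0"
  by (simp add: const_def partial_single)

lemma partial_var: "partial i (var j) = (if i = j then 1 else 0)"
  by (simp add: var_def partial_single lookup_single when_def)

text \<open>Both sides are additive in \<open>p\<close> and in \<open>q\<close>, so monomials
  suffice.\<close>

lemma partial_mult: "partial i (p * q) = partial i p * q + p * partial i q"
proof (induction p rule: mpoly_single_induct)
  case (single \<alpha> a)
  show ?case
  proof (induction q rule: mpoly_single_induct)
    case (single \<beta> b)
    let ?e = "Poly_Mapping.single i (1::nat)"
    \<comment> \<open>Subtraction of exponents truncates, so the shift needs a positive exponent. If
      the exponent is zero, the term has coefficient zero.\<close>
    have shift: "\<alpha> + \<beta> - ?e = \<alpha> - ?e + \<beta>" if "Poly_Mapping.lookup \<alpha> i \<noteq> 0"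
      for \<alpha> \<beta> :: "'a \<Rightarrow>\<^sub>0 nat"
      by (rule poly_mapping_eqI)
         (use that in \<open>auto simp: lookup_add lookup_minus lookup_single when_def\<close>)
    have "Poly_Mapping.single (\<alpha> - ?e + \<beta>) (of_nat (Poly_Mapping.lookup \<alpha> i) * a * b) =
        Poly_Mapping.single (\<alpha> + \<beta> - ?e) (of_nat (Poly_Mapping.lookup \<alpha> i) * a * b)"
      using shift[of \<alpha> \<beta>] by (cases "Poly_Mapping.lookup \<alpha> i = 0") simp_all
    moreover have "Poly_Mapping.single (\<alpha> + (\<beta> - ?e)) (a * (of_nat (Poly_Mapping.lookup \<beta> i) * b)) =
        Poly_Mapping.single (\<alpha> + \<beta> - ?e) (of_nat (Poly_Mapping.lookup \<beta> i) * a * b)"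
      using shift[of \<beta> \<alpha>] by (cases "Poly_Mapping.lookup \<beta> i = 0") (simp_all add: ac_simps)
    ultimately show ?case
      by (simp add: mult_single partial_single lookup_add single_add[symmetric] algebra_simps)
  qed (simp add: partial_add algebra_simps)
qed (simp add: partial_add algebra_simps)

text \<open>The Euler operator is diagonal on monomials. This coefficient form also applies to
  inhomogeneous error terms.\<close>

lemma lookup_euler:
  fixes p :: "('n::finite, 'k::comm_ring_1) mpoly"
  shows "Poly_Mapping.lookup (\<Sum>i\<in>UNIV. partial i p * var i) \<alpha> =
    of_nat (mdeg \<alpha>) * Poly_Mapping.lookup p \<alpha>"
proof (induction p rule: mpoly_single_induct)
  case (single \<beta> c)
  have "partial i (Poly_Mapping.single \<beta> c) * var i =
      Poly_Mapping.single \<beta> (of_nat (Poly_Mapping.lookup \<beta> i) * c)" for i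
  proof (cases "Poly_Mapping.lookup \<beta> i = 0")
    case False
    then have "\<beta> - Poly_Mapping.single i 1 + Poly_Mapping.single i 1 = \<beta>"
      using exponent_eq_minus_single_iff[of \<beta> i] by metis
    then show ?thesis
      by (simp add: partial_single var_def mult_single)
  qed (simp add: partial_single)
  then show ?case
    by (simp add: lookup_sum lookup_single when_def mdeg_def sum_distrib_right)
next
  case (add p q)
  then show ?case
    by (simp add: partial_add distrib_left distrib_right sum.distrib lookup_add)
qed

lemma homogeneous_euler:
  fixes p :: "('n::finite, 'k::comm_ring_1) mpoly"
  assumes "homogeneous d p"
  shows "(\<Sum>i\<in>UNIV. partial i p * var i) = of_nat d * p"
proof (rule poly_mapping_eqI)
  fix \<alpha>
  show "Poly_Mapping.lookup (\<Sum>i\<in>UNIV. partial i p * var i) \<alpha> =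
      Poly_Mapping.lookup (of_nat d * p) \<alpha>"
    using assms by (cases "\<alpha> \<in> Poly_Mapping.keys p")
       (auto simp: lookup_euler lookup_of_nat_mult homogeneous_def in_keys_iff)
qed

section \<open>Substitution into polynomials\<close>

text \<open>One index set can then serve \<open>p\<close>, \<open>q\<close> and
  \<open>p + q\<close>, whose supports differ.\<close>

lemma subst_eq_sum_superset:
  assumes "finite S" "Poly_Mapping.keys p \<subseteq> S"
  shows "subst p G = (\<Sum>\<alpha>\<in>S.
    const (Poly_Mapping.lookup p \<alpha>) * (\<Prod>i\<in>UNIV. (G $ i) ^ Poly_Mapping.lookup \<alpha> i))"
  unfolding subst_def by (rule sum.mono_neutral_left) (use assms in \<open>auto simp: in_keys_iff\<close>)

lemma subst_add: "subst (p + q) G = subst p G + subst q G"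
proof -
  let ?S = "Poly_Mapping.keys p \<union> Poly_Mapping.keys q"
  have "Poly_Mapping.keys (p + q) \<subseteq> ?S"
    by (rule Poly_Mapping.keys_add)
  then show ?thesis
    by (simp add: subst_eq_sum_superset[of ?S] lookup_add const_add distrib_right sum.distrib)
qed

lemma subst_single:
  "subst (Poly_Mapping.single \<alpha> c) G = const c * (\<Prod>i\<in>UNIV. (G $ i) ^ Poly_Mapping.lookup \<alpha> i)"
  using subst_eq_sum_superset[of "{\<alpha>}" "Poly_Mapping.single \<alpha> c" G] by simp

lemma subst_const [simp]: "subst (const c) G = const c"
  using subst_single[of 0 c G] by (simp add: const_def)

lemma subst_var [simp]: "subst (var i) G = G $ i"
proof -
  have "subst (var i) G = (\<Prod>j\<in>UNIV. if j = i then G $ j else 1)"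
    unfolding var_def subst_single const_1 mult_1_left
    by (rule prod.cong) (auto simp: lookup_single when_def)
  then show ?thesis
    by (simp add: prod.delta)
qed

lemma subst_0 [simp]: "subst 0 G = 0"
  by (simp add: subst_def)

lemma subst_1 [simp]: "subst 1 G = 1"
  using subst_const[of 1 G] by simp

lemma subst_mult: "subst (p * q) G = subst p G * subst q G"
proof (induction p rule: mpoly_single_induct)
  case (single \<alpha> a)
  show ?case
  proof (induction q rule: mpoly_single_induct)
    case (single \<beta> b)
    show ?case
      by (simp add: mult_single subst_single const_mult lookup_add power_add prod.distrib mult_ac)
  qed (simp add: subst_add algebra_simps)
qed (simp add: subst_add algebra_simps)

lemma subst_diff: "subst (p - q) G = subst p G - subst q G"
  using subst_add[of "p - q" q G] by simp

lemma subst_sum: "subst (sum f A) G = (\<Sum>a\<in>A. subst (f a) G)"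
  by (induction A rule: infinite_finite_induct) (simp_all add: subst_add)

lemma subst_of_nat_mult: "subst (of_nat m * p) G = of_nat m * subst p G"
  by (induction m) (simp_all add: distrib_right subst_add)

lemma subst_id [simp]: "subst p polymap_id = p"
  by (induction p rule: mpoly_induct) (simp_all add: subst_add subst_mult polymap_id_def)

lemma subst_subst: "subst (subst p F) G = subst p (polymap_compose F G)"
  by (induction p rule: mpoly_induct) (simp_all add: subst_add subst_mult polymap_compose_def)

text \<open>Chain rule. Both sides are derivations along the homomorphism that substitutes
  \<open>G\<close>, so agreement on constants and variables suffices.\<close>

lemma partial_subst:
  "partial i (subst p G) = (\<Sum>j\<in>UNIV. subst (partial j p) G * partial i (G $ j))"
proof (induction p rule: mpoly_induct)
  case (var k)
  have "(\<Sum>j\<in>UNIV. subst (partial j (var k)) G * partial i (G $ j)) =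
      (\<Sum>j\<in>UNIV. if j = k then partial i (G $ j) else 0)"
    by (rule sum.cong) (simp_all add: partial_var)
  then show ?case
    by (simp add: sum.delta)
next
  case (mult p q)
  then show ?case
    by (simp add: subst_mult partial_mult subst_add distrib_left distrib_right sum.distrib
        sum_distrib_left sum_distrib_right mult_ac)
qed (simp_all add: subst_add partial_add distrib_right sum.distrib)

section \<open>Composition of polynomial maps and their Jacobian matrices\<close>

lemma polymap_compose_assoc:
  "polymap_compose (polymap_compose F G) E = polymap_compose F (polymap_compose G E)"
  by (simp add: polymap_compose_def subst_subst vec_eq_iff)

lemma polymap_compose_id [simp]:
  "polymap_compose F polymap_id = F" "polymap_compose polymap_id F = F"
  by (simp_all add: polymap_compose_def vec_eq_iff) (simp add: polymap_id_def)

lemma is_polymap_inverse_unique: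
  assumes "is_polymap_inverse F G" "is_polymap_inverse F G'"
  shows "G = G'"
  using assms polymap_compose_assoc[of G F G'] by (simp add: is_polymap_inverse_def)

lemma polymap_inverse_eqI:
  assumes "is_polymap_inverse F G"
  shows "polymap_inverse F = G"
  unfolding polymap_inverse_def
  using assms is_polymap_inverse_unique by (intro the_equality) blast+

lemma polymap_compose_add: "polymap_compose (P + Q) G = polymap_compose P G + polymap_compose Q G"
  by (simp add: polymap_compose_def subst_add vec_eq_iff)

lemma polymap_compose_diff: "polymap_compose (P - Q) G = polymap_compose P G - polymap_compose Q G"
  by (simp add: polymap_compose_def subst_diff vec_eq_iff)

lemma polymap_compose_scalar:
  "polymap_compose (of_nat m *s P) G = of_nat m *s polymap_compose P G"
  by (simp add: polymap_compose_def subst_of_nat_mult vec_eq_iff)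

text \<open>This is the factor (JP)(G) in the chain rule J(P(G)) = (JP)(G) JG.\<close>

definition matrix_compose :: "('n::finite, 'k::comm_ring_1) mpoly ^ 'n ^ 'n \<Rightarrow> ('n, 'k) polymap \<Rightarrow>
    ('n, 'k) mpoly ^ 'n ^ 'n" where
  "matrix_compose A G = (\<chi> i j. subst (A $ i $ j) G)"

lemma polymap_compose_matrix_vector_mult:
  "polymap_compose (A *v P) G = matrix_compose A G *v polymap_compose P G"
  by (simp add: polymap_compose_def matrix_compose_def matrix_vector_mult_def subst_sum subst_mult
      vec_eq_iff)

lemma jacobian_matrix_compose:
  "jacobian_matrix (polymap_compose P G) = matrix_compose (jacobian_matrix P) G ** jacobian_matrix G"
  by (simp add: polymap_compose_def jacobian_matrix_def matrix_compose_def matrix_matrix_mult_def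
      partial_subst vec_eq_iff)

lemma jacobian_matrix_add: "jacobian_matrix (P + Q) = jacobian_matrix P + jacobian_matrix Q"
  by (simp add: jacobian_matrix_def partial_add vec_eq_iff)

lemma jacobian_matrix_diff: "jacobian_matrix (P - Q) = jacobian_matrix P - jacobian_matrix Q"
  by (simp add: jacobian_matrix_def partial_diff vec_eq_iff)

lemma jacobian_matrix_id: "jacobian_matrix polymap_id = mat 1"
  by (auto simp: jacobian_matrix_def polymap_id_def partial_var mat_def vec_eq_iff)

lemma matrix_vector_mult_scalar:
  fixes A :: "'a::comm_semiring_1 ^ 'n ^ 'm"
  shows "A *v (c *s v) = c *s (A *v v)"
  by (simp add: matrix_vector_mult_def vector_scalar_mult_def vec_eq_iff sum_distrib_left mult_ac)

lemma jacobian_matrix_euler: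
  assumes "\<forall>i. homogeneous d (P $ i)"
  shows "jacobian_matrix P *v polymap_id = of_nat d *s P"
  using assms
  by (simp add: matrix_vector_mult_def jacobian_matrix_def polymap_id_def homogeneous_euler vec_eq_iff)

section \<open>The order filtration\<close>

text \<open>A predicate rather than an order function, so that the zero series, of infinite order,
  needs no special value.\<close>

definition mps_order_ge :: "nat \<Rightarrow> ('n::finite, 'k::comm_ring_1) mps \<Rightarrow> bool" where
  "mps_order_ge k f \<longleftrightarrow> (\<forall>\<alpha>. mdeg \<alpha> < k \<longrightarrow> mps_coeff f \<alpha> = 0)"

lemma mps_coeff_simps [simp]:
  "mps_coeff 0 \<alpha> = 0"
  "mps_coeff 1 \<alpha> = (if \<alpha> = 0 then 1 else 0)"
  "mps_coeff (f + g) \<alpha> = mps_coeff f \<alpha> + mps_coeff g \<alpha>"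
  "mps_coeff (f - g) \<alpha> = mps_coeff f \<alpha> - mps_coeff g \<alpha>"
  "mps_coeff (f * g) \<alpha> = (\<Sum>(\<beta>, \<gamma>)\<in>splits \<alpha>. mps_coeff f \<beta> * mps_coeff g \<gamma>)"
  by (simp_all add: zero_mps_def one_mps_def plus_mps_def minus_mps_def times_mps_def)

lemma mem_splits [simp]: "(\<beta>, \<gamma>) \<in> splits \<alpha> \<longleftrightarrow> \<beta> + \<gamma> = \<alpha>"
  by (simp add: splits_def)

lemma mps_order_ge_0 [simp]: "mps_order_ge 0 f" "mps_order_ge k 0"
  by (simp_all add: mps_order_ge_def)

lemma mps_order_ge_mono: "mps_order_ge k f \<Longrightarrow> l \<le> k \<Longrightarrow> mps_order_ge l f"
  by (auto simp: mps_order_ge_def)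

lemma mps_order_ge_add: "mps_order_ge k f \<Longrightarrow> mps_order_ge k g \<Longrightarrow> mps_order_ge k (f + g)"
  by (auto simp: mps_order_ge_def)

lemma mps_order_ge_diff: "mps_order_ge k f \<Longrightarrow> mps_order_ge k g \<Longrightarrow> mps_order_ge k (f - g)"
  by (auto simp: mps_order_ge_def)

lemma mps_order_ge_mult:
  fixes f g :: "('n::finite, 'k::comm_ring_1) mps"
  assumes "mps_order_ge k f" "mps_order_ge l g"
  shows "mps_order_ge (k + l) (f * g)"
  unfolding mps_order_ge_def mps_coeff_simps
proof (intro allI impI sum.neutral ballI)
  fix \<alpha> :: "'n \<Rightarrow>\<^sub>0 nat" and x
  assume "mdeg \<alpha> < k + l" and "x \<in> splits \<alpha>"
  then have "mdeg (fst x) < k \<or> mdeg (snd x) < l"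
    by (auto simp: splits_def mdeg_add)
  then show "(case x of (\<beta>, \<gamma>) \<Rightarrow> mps_coeff f \<beta> * mps_coeff g \<gamma>) = 0"
    using assms by (auto simp: mps_order_ge_def split: prod.splits)
qed

text \<open>The filtration is separated. Raising the order step by step therefore proves that a
  series vanishes.\<close>

lemma mps_order_ge_all_imp_0:
  assumes "\<And>k. mps_order_ge k f"
  shows "f = 0"
proof (rule mps_eqI)
  fix \<alpha>
  show "mps_coeff f \<alpha> = mps_coeff 0 \<alpha>"
    using assms[of "Suc (mdeg \<alpha>)"] by (simp add: mps_order_ge_def)
qed

text \<open>
  Replacing one of \<open>n\<close> factors of order at least \<open>1\<close> by a factor congruent to it modulo order
  \<open>k + 1\<close> changes the product only in order at least \<open>k + n\<close>. Keeping the bound on the product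
  itself in the statement makes it stable under multiplication.
\<close>

lemma mps_congruent_mult:
  assumes "mps_order_ge m f" "mps_order_ge m f'" "mps_order_ge (k + m) (f - f')"
    and "mps_order_ge n g" "mps_order_ge n g'" "mps_order_ge (k + n) (g - g')"
  shows "mps_order_ge (m + n) (f * g) \<and> mps_order_ge (m + n) (f' * g') \<and>
    mps_order_ge (k + (m + n)) (f * g - f' * g')"
proof -
  have "f * g - f' * g' = f * (g - g') + (f - f') * g'"
    by (simp add: algebra_simps)
  moreover have "mps_order_ge (m + (k + n)) (f * (g - g'))"
    by (intro mps_order_ge_mult assms)
  moreover have "mps_order_ge (k + m + n) ((f - f') * g')"
    by (intro mps_order_ge_mult assms)
  ultimately have "mps_order_ge (k + (m + n)) (f * g - f' * g')"
    using mps_order_ge_add[of "k + (m + n)"] by (simp add: ac_simps)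
  then show ?thesis
    using assms by (auto intro: mps_order_ge_mult)
qed

lemma mps_congruent_monomial:
  fixes g g' :: "('n::finite, 'k::comm_ring_1) mps ^ 'n"
  assumes "\<And>i. mps_order_ge 1 (g $ i)" "\<And>i. mps_order_ge 1 (g' $ i)"
    and "\<And>i. mps_order_ge (k + 1) (g $ i - g' $ i)"
  shows "mps_order_ge (mdeg \<beta>) (\<Prod>i\<in>UNIV. (g $ i) ^ Poly_Mapping.lookup \<beta> i) \<and>
    mps_order_ge (mdeg \<beta>) (\<Prod>i\<in>UNIV. (g' $ i) ^ Poly_Mapping.lookup \<beta> i) \<and>
    mps_order_ge (k + mdeg \<beta>)
      ((\<Prod>i\<in>UNIV. (g $ i) ^ Poly_Mapping.lookup \<beta> i) - (\<Prod>i\<in>UNIV. (g' $ i) ^ Poly_Mapping.lookup \<beta> i))"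
proof -
  have power: "mps_order_ge m ((g $ i) ^ m) \<and> mps_order_ge m ((g' $ i) ^ m) \<and>
      mps_order_ge (k + m) ((g $ i) ^ m - (g' $ i) ^ m)" for i m
  proof (induction m)
    case (Suc m)
    then show ?case
      using mps_congruent_mult[of 1 "g $ i" "g' $ i" k m "(g $ i) ^ m" "(g' $ i) ^ m"] assms
      by simp
  qed simp
  have "mps_order_ge (\<Sum>i\<in>A. e i) (\<Prod>i\<in>A. (g $ i) ^ e i) \<and>
      mps_order_ge (\<Sum>i\<in>A. e i) (\<Prod>i\<in>A. (g' $ i) ^ e i) \<and>
      mps_order_ge (k + (\<Sum>i\<in>A. e i)) ((\<Prod>i\<in>A. (g $ i) ^ e i) - (\<Prod>i\<in>A. (g' $ i) ^ e i))"
    if "finite A" for A :: "'n set" and e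
    using that
  proof (induction A)
    case (insert a A)
    then show ?case
      using power[where m = "e a" and i = a]
        mps_congruent_mult[of "e a" "(g $ a) ^ e a" "(g' $ a) ^ e a" k
          "\<Sum>i\<in>A. e i" "\<Prod>i\<in>A. (g $ i) ^ e i" "\<Prod>i\<in>A. (g' $ i) ^ e i"]
      by simp
  qed simp
  then show ?thesis
    by (simp add: mdeg_def)
qed

lemma mps_order_ge_monomial:
  fixes g :: "('n::finite, 'k::comm_ring_1) mps ^ 'n"
  assumes "\<And>i. mps_order_ge 1 (g $ i)"
  shows "mps_order_ge (mdeg \<beta>) (\<Prod>i\<in>UNIV. (g $ i) ^ Poly_Mapping.lookup \<beta> i)"
  using mps_congruent_monomial[of g g 0 \<beta>] assms by simp

section \<open>Substitution into power series\<close>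

lemma mps_coeff_subst:
  "mps_coeff (mps_subst f g) \<alpha> = (\<Sum>\<beta> | mdeg \<beta> \<le> mdeg \<alpha>.
     mps_coeff f \<beta> * mps_coeff (\<Prod>i\<in>UNIV. (g $ i) ^ Poly_Mapping.lookup \<beta> i) \<alpha>)"
  by (simp add: mps_subst_def)

lemma mps_subst_diff: "mps_subst (f - f') g = mps_subst f g - mps_subst f' g"
  by (rule mps_eqI) (simp add: mps_coeff_subst left_diff_distrib sum_subtractf)

lemma mps_order_ge_subst:
  assumes "mps_order_ge n f" "\<And>i. mps_order_ge 1 (g $ i)"
  shows "mps_order_ge n (mps_subst f g)"
  unfolding mps_order_ge_def mps_coeff_subst
  by (intro allI impI sum.neutral ballI)
     (use assms(1) in \<open>auto simp: mps_order_ge_def\<close>)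

text \<open>Terms with |\<beta>| < n drop out because \<open>f\<close> has order at least
  \<open>n\<close>, and the remaining monomials agree below degree k + |\<beta>|. For n = 2
  agreement improves from order k + 1 to k + 2, so substitution into such an \<open>f\<close> is
  contracting.\<close>

lemma mps_congruent_subst:
  assumes "mps_order_ge n f" "\<And>i. mps_order_ge 1 (g $ i)" "\<And>i. mps_order_ge 1 (g' $ i)"
    and "\<And>i. mps_order_ge (k + 1) (g $ i - g' $ i)"
  shows "mps_order_ge (k + n) (mps_subst f g - mps_subst f g')"
proof -
  have "mps_coeff f \<beta> * mps_coeff (\<Prod>i\<in>UNIV. (g $ i) ^ Poly_Mapping.lookup \<beta> i) \<alpha> =
      mps_coeff f \<beta> * mps_coeff (\<Prod>i\<in>UNIV. (g' $ i) ^ Poly_Mapping.lookup \<beta> i) \<alpha>"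
    if "mdeg \<alpha> < k + n" for \<alpha> \<beta>
  proof (cases "mdeg \<beta> < n")
    case True
    then show ?thesis
      using assms(1) by (simp add: mps_order_ge_def)
  next
    case False
    then have "mdeg \<alpha> < k + mdeg \<beta>"
      using that by simp
    moreover have "mps_order_ge (k + mdeg \<beta>) ((\<Prod>i\<in>UNIV. (g $ i) ^ Poly_Mapping.lookup \<beta> i) -
        (\<Prod>i\<in>UNIV. (g' $ i) ^ Poly_Mapping.lookup \<beta> i))"
      using mps_congruent_monomial[of g g' k \<beta>] assms by blast
    ultimately show ?thesis
      by (simp add: mps_order_ge_def)
  qed
  then have "mps_coeff (mps_subst f g) \<alpha> = mps_coeff (mps_subst f g') \<alpha>" if "mdeg \<alpha> < k + n" for \<alpha>
    using that by (simp add: mps_coeff_subst)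
  then show ?thesis
    by (simp add: mps_order_ge_def)
qed

section \<open>Polynomials as power series\<close>

lemma mps_coeff_of_poly [simp]: "mps_coeff (mps_of_poly p) \<alpha> = Poly_Mapping.lookup p \<alpha>"
  by (simp add: mps_of_poly_def)

lemma mps_of_poly_inject: "mps_of_poly p = mps_of_poly q \<longleftrightarrow> p = q"
  by (metis mps_coeff_of_poly poly_mapping_eqI)

lemma mps_of_poly_0 [simp]: "mps_of_poly 0 = 0"
  by (rule mps_eqI) simp

lemma mps_of_poly_1 [simp]: "mps_of_poly 1 = 1"
  by (rule mps_eqI) (auto simp: lookup_one when_def)

lemma mps_of_poly_add: "mps_of_poly (p + q) = mps_of_poly p + mps_of_poly q"
  by (rule mps_eqI) (simp add: lookup_add)

lemma mps_of_poly_diff: "mps_of_poly (p - q) = mps_of_poly p - mps_of_poly q"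
  by (rule mps_eqI) (simp add: lookup_minus)

lemma mps_of_poly_sum: "mps_of_poly (sum f A) = (\<Sum>a\<in>A. mps_of_poly (f a))"
  by (induction A rule: infinite_finite_induct) (simp_all add: mps_of_poly_add)

lemma mps_of_poly_mult:
  fixes p q :: "('n::finite, 'k::comm_ring_1) mpoly"
  shows "mps_of_poly (p * q) = mps_of_poly p * mps_of_poly q"
proof (induction p rule: mpoly_single_induct)
  case (single \<alpha> a)
  show ?case
  proof (induction q rule: mpoly_single_induct)
    case (single \<beta> b)
    show ?case
    proof (rule mps_eqI)
      fix \<gamma>
      have "(\<Sum>(\<delta>, \<epsilon>)\<in>splits \<gamma>. Poly_Mapping.lookup (Poly_Mapping.single \<alpha> a) \<delta> *
            Poly_Mapping.lookup (Poly_Mapping.single \<beta> b) \<epsilon>) =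
          (\<Sum>x\<in>splits \<gamma>. if x = (\<alpha>, \<beta>) then a * b else 0)"
        by (rule sum.cong) (auto simp: lookup_single when_def split: if_splits)
      also have "\<dots> = (if \<alpha> + \<beta> = \<gamma> then a * b else 0)"
        by (simp add: sum.delta)
      finally show "mps_coeff (mps_of_poly (Poly_Mapping.single \<alpha> a * Poly_Mapping.single \<beta> b)) \<gamma> =
          mps_coeff (mps_of_poly (Poly_Mapping.single \<alpha> a) * mps_of_poly (Poly_Mapping.single \<beta> b)) \<gamma>"
        by (simp add: mult_single lookup_single when_def)
    qed
  qed (simp add: mps_of_poly_add distrib_left)
qed (simp add: mps_of_poly_add distrib_right)

lemma mps_of_poly_power: "mps_of_poly (p ^ m) = mps_of_poly p ^ m"
  by (induction m) (simp_all add: mps_of_poly_mult)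

lemma mps_of_poly_prod: "mps_of_poly (prod f A) = (\<Prod>a\<in>A. mps_of_poly (f a))"
  by (induction A rule: infinite_finite_induct) (simp_all add: mps_of_poly_mult)

lemma mps_coeff_const_mult: "mps_coeff (mps_of_poly (const c) * f) \<alpha> = c * mps_coeff f \<alpha>"
proof -
  have "(\<Sum>(\<beta>, \<gamma>)\<in>splits \<alpha>. Poly_Mapping.lookup (const c) \<beta> * mps_coeff f \<gamma>) =
      (\<Sum>x\<in>splits \<alpha>. if x = (0, \<alpha>) then c * mps_coeff f \<alpha> else 0)"
    by (rule sum.cong) (auto simp: const_def lookup_single when_def split: if_splits)
  then show ?thesis
    by (simp add: sum.delta)
qed

text \<open>\<open>mps_subst\<close> cuts the sum off at |\<beta>| \<le> |\<alpha>|, while the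
  right-hand side runs over the support of \<open>p\<close>. Exponents beyond the cutoff contribute
  zero because no component of \<open>g\<close> has a constant term.\<close>

lemma mps_subst_of_poly:
  assumes "\<And>i. mps_order_ge 1 (g $ i)"
  shows "mps_subst (mps_of_poly p) g = (\<Sum>\<beta>\<in>Poly_Mapping.keys p.
    mps_of_poly (const (Poly_Mapping.lookup p \<beta>)) * (\<Prod>i\<in>UNIV. (g $ i) ^ Poly_Mapping.lookup \<beta> i))"
    (is "_ = (\<Sum>\<beta>\<in>_. _ * ?M \<beta>)")
proof (rule mps_eqI)
  fix \<alpha>
  have coeff_sum: "mps_coeff (sum f A) \<alpha> = (\<Sum>a\<in>A. mps_coeff (f a) \<alpha>)"
    for f :: "_ \<Rightarrow> ('a, 'b) mps" and A
    by (induction A rule: infinite_finite_induct) simp_all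
  have small: "mps_coeff (?M \<beta>) \<alpha> = 0" if "mdeg \<alpha> < mdeg \<beta>" for \<beta>
    using mps_order_ge_monomial[OF assms, of \<beta>] that by (simp add: mps_order_ge_def)
  have "mps_coeff (mps_subst (mps_of_poly p) g) \<alpha> =
      (\<Sum>\<beta>\<in>{\<beta>. mdeg \<beta> \<le> mdeg \<alpha>} \<union> Poly_Mapping.keys p. Poly_Mapping.lookup p \<beta> * mps_coeff (?M \<beta>) \<alpha>)"
    unfolding mps_coeff_subst mps_coeff_of_poly
    by (rule sum.mono_neutral_left) (auto simp: finite_mdeg_le small)
  also have "\<dots> = (\<Sum>\<beta>\<in>Poly_Mapping.keys p. Poly_Mapping.lookup p \<beta> * mps_coeff (?M \<beta>) \<alpha>)"
    by (rule sum.mono_neutral_right) (auto simp: finite_mdeg_le in_keys_iff)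
  also have "\<dots> = mps_coeff (\<Sum>\<beta>\<in>Poly_Mapping.keys p.
      mps_of_poly (const (Poly_Mapping.lookup p \<beta>)) * ?M \<beta>) \<alpha>"
    unfolding coeff_sum mps_coeff_const_mult ..
  finally show "mps_coeff (mps_subst (mps_of_poly p) g) \<alpha> = mps_coeff (\<Sum>\<beta>\<in>Poly_Mapping.keys p.
      mps_of_poly (const (Poly_Mapping.lookup p \<beta>)) * ?M \<beta>) \<alpha>" .
qed

text \<open>Defined through the embedding, so that the estimates for series carry over.\<close>

definition order_ge :: "nat \<Rightarrow> ('n::finite, 'k::comm_ring_1) mpoly \<Rightarrow> bool" where
  "order_ge k p \<longleftrightarrow> mps_order_ge k (mps_of_poly p)"

lemma mps_of_poly_subst:
  assumes "\<And>i. order_ge 1 (G $ i)"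
  shows "mps_of_poly (subst p G) = mps_subst (mps_of_poly p) (mpsmap_of_polymap G)"
  using assms
  by (simp add: mps_subst_of_poly mpsmap_of_polymap_def order_ge_def subst_def mps_of_poly_sum
      mps_of_poly_mult mps_of_poly_prod mps_of_poly_power)

text \<open>The two notions of composition agree when the inner map has no constant term. This turns
  a polynomial inverse into a formal one.\<close>

lemma mpsmap_of_polymap_compose:
  assumes "\<And>i. order_ge 1 (G $ i)"
  shows "mpsmap_of_polymap (polymap_compose F G) =
    mpsmap_compose (mpsmap_of_polymap F) (mpsmap_of_polymap G)"
  using mps_of_poly_subst[OF assms]
  by (simp add: mpsmap_of_polymap_def mpsmap_compose_def polymap_compose_def)

lemma order_geI: "(\<And>\<alpha>. mdeg \<alpha> < k \<Longrightarrow> Poly_Mapping.lookup p \<alpha> = 0) \<Longrightarrow> order_ge k p"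
  by (simp add: order_ge_def mps_order_ge_def)

lemma order_geD: "order_ge k p \<Longrightarrow> mdeg \<alpha> < k \<Longrightarrow> Poly_Mapping.lookup p \<alpha> = 0"
  by (simp add: order_ge_def mps_order_ge_def)

lemma order_ge_mono: "order_ge k p \<Longrightarrow> l \<le> k \<Longrightarrow> order_ge l p"
  unfolding order_ge_def by (rule mps_order_ge_mono)

lemma order_ge_all_imp_0: "(\<And>k. order_ge k p) \<Longrightarrow> p = 0"
  using mps_order_ge_all_imp_0[of "mps_of_poly p"] mps_of_poly_inject[of p 0]
  by (simp add: order_ge_def)

lemma order_ge_0 [simp]: "order_ge 0 p" "order_ge k 0"
  by (simp_all add: order_ge_def)

lemma order_ge_add: "order_ge k p \<Longrightarrow> order_ge k q \<Longrightarrow> order_ge k (p + q)"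
  by (simp add: order_ge_def mps_of_poly_add mps_order_ge_add)

lemma order_ge_diff: "order_ge k p \<Longrightarrow> order_ge k q \<Longrightarrow> order_ge k (p - q)"
  by (simp add: order_ge_def mps_of_poly_diff mps_order_ge_diff)

lemma order_ge_sum: "(\<And>a. a \<in> A \<Longrightarrow> order_ge k (f a)) \<Longrightarrow> order_ge k (sum f A)"
  by (induction A rule: infinite_finite_induct) (auto intro: order_ge_add)

lemma order_ge_mult: "order_ge k p \<Longrightarrow> order_ge l q \<Longrightarrow> order_ge (k + l) (p * q)"
  unfolding order_ge_def mps_of_poly_mult by (rule mps_order_ge_mult)

lemma order_ge_partial:
  assumes "order_ge (Suc k) p"
  shows "order_ge k (partial i p)"
proof (rule order_geI)
  fix \<alpha> :: "'a \<Rightarrow>\<^sub>0 nat"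
  assume "mdeg \<alpha> < k"
  then have "mdeg (\<alpha> + Poly_Mapping.single i 1) < Suc k"
    by (simp add: mdeg_add)
  then show "Poly_Mapping.lookup (partial i p) \<alpha> = 0"
    using order_geD[OF assms] by (simp add: lookup_partial)
qed

lemma order_ge_homogeneous: "homogeneous d p \<Longrightarrow> order_ge d p"
  by (rule order_geI) (auto simp: homogeneous_def in_keys_iff)

lemma order_ge_var: "order_ge 1 (var i)"
  by (rule order_geI) (auto simp: var_def lookup_single when_def)

lemma order_ge_subst:
  assumes "order_ge n p" "\<And>i. order_ge 1 (G $ i)"
  shows "order_ge n (subst p G)"
  unfolding order_ge_def mps_of_poly_subst[OF assms(2)]
  by (rule mps_order_ge_subst) (use assms in \<open>simp_all add: order_ge_def mpsmap_of_polymap_def\<close>)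

lemma congruent_subst:
  assumes "order_ge n p" "\<And>i. order_ge 1 (G $ i)" "\<And>i. order_ge 1 (G' $ i)"
    and "\<And>i. order_ge (k + 1) (G $ i - G' $ i)"
  shows "order_ge (k + n) (subst p G - subst p G')"
  unfolding order_ge_def mps_of_poly_diff mps_of_poly_subst[OF assms(2)] mps_of_poly_subst[OF assms(3)]
  by (rule mps_congruent_subst)
     (use assms in \<open>simp_all add: order_ge_def mpsmap_of_polymap_def mps_of_poly_diff\<close>)

section \<open>Homogeneous polynomials\<close>

lemma homogeneous_iff: "homogeneous d p \<longleftrightarrow> (\<forall>\<alpha>. Poly_Mapping.lookup p \<alpha> \<noteq> 0 \<longrightarrow> mdeg \<alpha> = d)"
  by (auto simp: homogeneous_def in_keys_iff)

lemma homogeneous_0 [simp]: "homogeneous d 0"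
  by (simp add: homogeneous_def)

lemma homogeneous_add: "homogeneous d p \<Longrightarrow> homogeneous d q \<Longrightarrow> homogeneous d (p + q)"
  by (unfold homogeneous_iff lookup_add) (metis add_0)

lemma homogeneous_sum: "(\<And>a. a \<in> A \<Longrightarrow> homogeneous d (f a)) \<Longrightarrow> homogeneous d (sum f A)"
  by (induction A rule: infinite_finite_induct) (auto intro: homogeneous_add)

lemma homogeneous_mult:
  assumes "homogeneous d p" "homogeneous e q"
  shows "homogeneous (d + e) (p * q)"
  unfolding homogeneous_def
proof
  fix \<alpha>
  assume "\<alpha> \<in> Poly_Mapping.keys (p * q)"
  then obtain \<beta> \<gamma> where "\<alpha> = \<beta> + \<gamma>" "\<beta> \<in> Poly_Mapping.keys p" "\<gamma> \<in> Poly_Mapping.keys q"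
    using keys_mult[of p q] by auto
  then show "mdeg \<alpha> = d + e"
    using assms by (simp add: homogeneous_def mdeg_add)
qed

lemma homogeneous_partial:
  assumes "homogeneous d p"
  shows "homogeneous (d - 1) (partial i p)"
  unfolding homogeneous_iff
proof (intro allI impI)
  fix \<alpha> :: "'a \<Rightarrow>\<^sub>0 nat"
  assume "Poly_Mapping.lookup (partial i p) \<alpha> \<noteq> 0"
  then have "Poly_Mapping.lookup p (\<alpha> + Poly_Mapping.single i 1) \<noteq> 0"
    by (auto simp: lookup_partial)
  then have "mdeg (\<alpha> + Poly_Mapping.single i 1) = d"
    using assms by (simp add: homogeneous_iff)
  then show "mdeg \<alpha> = d - 1"
    by (simp add: mdeg_add)
qed

lemma homogeneous_var: "homogeneous 1 (var i)"
  by (simp add: homogeneous_iff var_def lookup_single when_def)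

section \<open>Homogeneous parts and total degree\<close>

lemma lookup_hom_part:
  fixes f :: "('n::finite, 'k::comm_ring_1) mps"
  shows "Poly_Mapping.lookup (hom_part k f) \<alpha> = (if mdeg \<alpha> = k then mps_coeff f \<alpha> else 0)"
proof -
  have "finite {\<alpha>::'n \<Rightarrow>\<^sub>0 nat. mdeg \<alpha> = k}"
    by (rule finite_subset[OF _ finite_mdeg_le[of k]]) auto
  then show ?thesis
    by (simp add: hom_part_def lookup_sum lookup_single when_def sum.delta)
qed

lemma hom_part_add: "hom_part k (f + g) = hom_part k f + hom_part k g"
  by (rule poly_mapping_eqI) (simp add: lookup_hom_part lookup_add)

lemma hom_part_homogeneous:
  assumes "homogeneous d p"
  shows "hom_part k (mps_of_poly p) = (if k = d then p else 0)"
  by (rule poly_mapping_eqI) (use assms in \<open>auto simp: lookup_hom_part homogeneous_iff\<close>)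

lemma tdeg_le_iff: "tdeg p \<le> m \<longleftrightarrow> (\<forall>\<alpha>\<in>Poly_Mapping.keys p. mdeg \<alpha> \<le> m)"
  by (simp add: tdeg_def)

lemma tdeg_add_le: "tdeg p \<le> m \<Longrightarrow> tdeg q \<le> m \<Longrightarrow> tdeg (p + q) \<le> m"
  using Poly_Mapping.keys_add[of p q] by (auto simp: tdeg_le_iff)

lemma tdeg_homogeneous_le: "homogeneous d p \<Longrightarrow> d \<le> m \<Longrightarrow> tdeg p \<le> m"
  by (simp add: tdeg_le_iff homogeneous_def)


section \<open>The formal inverse of a polynomial automorphism\<close>

lemma mps_subst_var:
  assumes "\<And>i. mps_order_ge 1 (g $ i)"
  shows "mps_subst (mps_of_poly (var i)) g = g $ i"
proof -
  have "(\<Prod>j\<in>UNIV. (g $ j) ^ Poly_Mapping.lookup (Poly_Mapping.single i 1) j) =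
      (\<Prod>j\<in>UNIV. if j = i then g $ j else 1)"
    by (rule prod.cong) (auto simp: lookup_single when_def)
  then show ?thesis
    unfolding mps_subst_of_poly[OF assms] by (simp add: var_def prod.delta)
qed

text \<open>Composing \<open>polymap_id - H\<close> with \<open>g\<close> gives X - H, evaluated at
  \<open>g\<close>, equal to X, that is g = X + H(g). Since \<open>H\<close> has order at least 2,
  the right-hand side is a contraction for the order filtration, so it has at most one fixed
  point.\<close>

lemma is_formal_inverse_unique:
  fixes H :: "('n::finite, 'k::comm_ring_1) polymap"
  assumes H: "\<And>i. order_ge 2 (H $ i)"
    and g: "is_formal_inverse (polymap_id - H) g" and g': "is_formal_inverse (polymap_id - H) g'"
  shows "g = g'"
proof -
  have order: "mps_order_ge 1 (g $ i)" if "is_formal_inverse (polymap_id - H) g"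
    for g :: "('n, 'k) mps ^ 'n" and i
    using that order_geD[OF order_ge_var, of _ i]
    by (auto simp: is_formal_inverse_def mps_order_ge_def)
  have fixpoint: "g $ i = mps_of_poly (var i) + mps_subst (mps_of_poly (H $ i)) g"
    if "is_formal_inverse (polymap_id - H) g" for g :: "('n, 'k) mps ^ 'n" and i
  proof -
    have "mps_of_poly (var i) = mps_subst (mps_of_poly (var i - H $ i)) g"
      using that
      by (simp add: is_formal_inverse_def mpsmap_compose_def mpsmap_of_polymap_def polymap_id_def
          vec_eq_iff)
    then show ?thesis
      using mps_subst_var[OF order[OF that]] by (simp add: mps_of_poly_diff mps_subst_diff)
  qed
  have "\<forall>i. mps_order_ge (k + 1) (g $ i - g' $ i)" for k
  proof (induction k)
    case 0
    show ?case
      using order[OF g] order[OF g'] by (simp add: mps_order_ge_diff)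
  next
    case (Suc k)
    show ?case
    proof
      fix i
      have "mps_order_ge (k + 2) (mps_subst (mps_of_poly (H $ i)) g - mps_subst (mps_of_poly (H $ i)) g')"
        by (rule mps_congruent_subst)
           (use H order[OF g] order[OF g'] Suc in \<open>simp_all add: order_ge_def\<close>)
      moreover have "g $ i - g' $ i =
          mps_subst (mps_of_poly (H $ i)) g - mps_subst (mps_of_poly (H $ i)) g'"
        using fixpoint[OF g, of i] fixpoint[OF g', of i] by (metis add_diff_cancel_left)
      ultimately show "mps_order_ge (Suc k + 1) (g $ i - g' $ i)"
        by simp
    qed
  qed
  then have "g $ i - g' $ i = 0" for i
    by (intro mps_order_ge_all_imp_0) (metis mps_order_ge_mono le_add1)
  then show ?thesis
    by (simp add: vec_eq_iff)
qed

lemma formal_inverse_eq_polymap: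
  fixes H :: "('n::finite, 'k::comm_ring_1) polymap"
  assumes H: "\<And>i. order_ge 2 (H $ i)" and U: "\<And>i. order_ge 2 (U $ i)"
    and inverse: "is_polymap_inverse (polymap_id - H) (polymap_id + U)"
  shows "formal_inverse (polymap_id - H) = mpsmap_of_polymap (polymap_id + U)"
proof -
  have order_F: "order_ge 1 ((polymap_id - H) $ i)" for i
    using order_ge_diff[OF order_ge_var order_ge_mono[OF H]] by (simp add: polymap_id_def)
  have order_G: "order_ge 1 ((polymap_id + U) $ i)" for i
    using order_ge_add[OF order_ge_var order_ge_mono[OF U]] by (simp add: polymap_id_def)
  have "is_formal_inverse (polymap_id - H) (mpsmap_of_polymap (polymap_id + U))"
    unfolding is_formal_inverse_def
  proof (intro conjI allI impI)
    fix i and \<alpha> :: "'n \<Rightarrow>\<^sub>0 nat"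
    assume "mdeg \<alpha> \<le> 1"
    then show "mps_coeff (mpsmap_of_polymap (polymap_id + U) $ i) \<alpha> = Poly_Mapping.lookup (var i) \<alpha>"
      using order_geD[OF U, of \<alpha> i]
      by (simp add: mpsmap_of_polymap_def polymap_id_def lookup_add)
  next
    show "mpsmap_compose (mpsmap_of_polymap (polymap_id - H)) (mpsmap_of_polymap (polymap_id + U)) =
        mpsmap_of_polymap polymap_id"
      using inverse mpsmap_of_polymap_compose[OF order_G, of "polymap_id - H"]
      by (simp add: is_polymap_inverse_def)
  next
    show "mpsmap_compose (mpsmap_of_polymap (polymap_id + U)) (mpsmap_of_polymap (polymap_id - H)) =
        mpsmap_of_polymap polymap_id"
      using inverse mpsmap_of_polymap_compose[OF order_F, of "polymap_id + U"]
      by (simp add: is_polymap_inverse_def)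
  qed
  then show ?thesis
    unfolding formal_inverse_def using is_formal_inverse_unique[OF H] by (intro the_equality) blast+
qed

section \<open>Symmetric Jacobian matrices with vanishing cube\<close>

text \<open>The standard bilinear form over an arbitrary commutative ring, where the real inner
  product is not at hand.\<close>

definition dot :: "'a::comm_ring_1 ^ 'n \<Rightarrow> 'a ^ 'n \<Rightarrow> 'a" where
  "dot v w = (\<Sum>i\<in>UNIV. v $ i * w $ i)"

lemma dot_symmetric_matrix:
  assumes "transpose A = A"
  shows "dot (A *v v) w = dot v (A *v w)"
proof -
  have A: "A $ i $ j = A $ j $ i" for i j
    using assms by (metis transpose_def vec_lambda_beta)
  have "dot (A *v v) w = (\<Sum>i\<in>UNIV. \<Sum>j\<in>UNIV. A $ i $ j * v $ j * w $ i)"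
    by (simp add: dot_def matrix_vector_mult_def sum_distrib_right)
  also have "\<dots> = (\<Sum>j\<in>UNIV. \<Sum>i\<in>UNIV. A $ i $ j * v $ j * w $ i)"
    by (rule sum.swap)
  also have "\<dots> = (\<Sum>j\<in>UNIV. \<Sum>i\<in>UNIV. v $ j * (A $ j $ i * w $ i))"
    by (intro sum.cong refl) (metis A mult.assoc mult.commute)
  also have "\<dots> = dot v (A *v w)"
    by (simp add: dot_def matrix_vector_mult_def sum_distrib_left)
  finally show ?thesis .
qed

lemma partial_dot:
  "partial i (dot P Q) =
    (transpose (jacobian_matrix P) *v Q + transpose (jacobian_matrix Q) *v P) $ i"
  by (simp add: dot_def partial_sum partial_mult sum.distrib matrix_vector_mult_def transpose_def
      jacobian_matrix_def mult_ac del: transpose_matrix_vector)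

text \<open>\<open>JH \<cdot> H\<close> is the gradient of \<open>\<langle>H, H\<rangle> / 2\<close>.\<close>

lemma jacobian_matrix_mult_symmetric:
  assumes "transpose (jacobian_matrix H) = jacobian_matrix H"
  shows "transpose (jacobian_matrix (jacobian_matrix H *v H)) = jacobian_matrix (jacobian_matrix H *v H)"
proof -
  have A: "partial j (H $ i) = partial i (H $ j)" for i j
    using assms by (simp add: jacobian_matrix_def transpose_def vec_eq_iff)
  \<comment> \<open>Writing the row entries as \<open>partial i (H $ j)\<close> makes the result
    symmetric in \<open>i\<close> and \<open>k\<close>, as second derivatives commute.\<close>
  have "partial k ((jacobian_matrix H *v H) $ i) =
      (\<Sum>j\<in>UNIV. partial k (partial i (H $ j)) * H $ j + partial i (H $ j) * partial k (H $ j))" for i k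
    by (simp add: jacobian_matrix_def matrix_vector_mult_def partial_sum partial_mult A[of _ i])
  then have "partial k ((jacobian_matrix H *v H) $ i) = partial i ((jacobian_matrix H *v H) $ k)" for i k
    by (simp add: partial_commute[of k i] mult.commute)
  then show ?thesis
    by (simp add: jacobian_matrix_def[of "jacobian_matrix H *v H"] transpose_def vec_eq_iff)
qed

text \<open>
  The three identities say that \<open>U\<^sub>t = H + t \<cdot> JH \<cdot> H\<close> solves the Burgers equation
  \<open>\<partial>U\<^sub>t/\<partial>t = JU\<^sub>t \<cdot> U\<^sub>t\<close>, whose solution with \<open>U\<^sub>0 = H\<close> inverts \<open>X - t \<cdot> H\<close> as \<open>X + t \<cdot> U\<^sub>t\<close>. They hold since
  \<open>\<langle>H, JH \<cdot> H\<rangle>\<close> and \<open>\<langle>JH \<cdot> H, JH \<cdot> H\<rangle>\<close> vanish: up to a factor, \<open>H\<close> is \<open>JH \<cdot> X\<close>.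
\<close>

lemma symmetric_cube_zero_identities:
  fixes \<phi> :: "rat \<Rightarrow> 'k::comm_ring_1" and H :: "('n::finite, 'k) polymap"
  assumes \<phi>: "rat_algebra \<phi>" and d: "d > 0" and hom: "\<forall>i. homogeneous d (H $ i)"
    and sym: "transpose (jacobian_matrix H) = jacobian_matrix H"
    and cube: "jacobian_matrix H ** jacobian_matrix H ** jacobian_matrix H = 0"
  shows "jacobian_matrix H *v (jacobian_matrix H *v H) = 0" (is "?A *v ?N = 0")
    and "jacobian_matrix (jacobian_matrix H *v H) *v H = 0"
    and "jacobian_matrix (jacobian_matrix H *v H) *v (jacobian_matrix H *v H) = 0"
proof -
  have euler: "?A *v polymap_id = of_nat d *s H"
    using hom by (rule jacobian_matrix_euler)
  \<comment> \<open>By Euler, d H = JH X, so d JH N is the vanishing cube applied to X.\<close>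
  have "of_nat d *s (?A *v ?N) = ?A *v (?A *v (?A *v polymap_id))"
    by (simp add: euler matrix_vector_mult_scalar)
  also have "\<dots> = 0"
    using cube by (simp add: matrix_vector_mul_assoc matrix_mul_assoc)
  finally show AN: "?A *v ?N = 0"
    by (rule rat_algebra_polymap_scalar_eq_0[OF \<phi> d])
  \<comment> \<open>Euler again, then symmetry moves JH onto \<open>?N\<close>, where it gives
    zero.\<close>
  have "of_nat d * dot H ?N = dot (?A *v polymap_id) ?N"
    by (simp add: euler dot_def sum_distrib_left mult_ac)
  also have "\<dots> = 0"
    by (simp add: dot_symmetric_matrix[OF sym] AN) (simp add: dot_def)
  finally have HN: "dot H ?N = 0"
    by (rule rat_algebra_mpoly_of_nat_mult_eq_0[OF \<phi> d])
  have NN: "dot ?N ?N = 0"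
    by (simp add: dot_symmetric_matrix[OF sym] AN) (simp add: dot_def)
  note sym' = jacobian_matrix_mult_symmetric[OF sym]
  \<comment> \<open>The gradient of the vanishing form \<open>dot H ?N\<close>; both Jacobian
    matrices are symmetric.\<close>
  have "?A *v ?N + jacobian_matrix ?N *v H = 0"
    using partial_dot[of _ H ?N] by (simp only: HN sym sym' partial_0 vec_eq_iff zero_index) simp
  then show "jacobian_matrix ?N *v H = 0"
    by (simp only: AN add_0)
  \<comment> \<open>The gradient of \<open>dot ?N ?N\<close> yields twice the desired vector, and 2
    can be cancelled.\<close>
  have "jacobian_matrix ?N *v ?N + jacobian_matrix ?N *v ?N = 0"
    using partial_dot[of _ ?N ?N] by (simp only: NN sym' partial_0 vec_eq_iff zero_index) simp
  moreover have "of_nat 2 *s v = v + v" for v :: "('n, 'k) polymap"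
    by (simp only: of_nat_numeral vec_eq_iff vector_smult_component vector_add_component mult_2) simp
  ultimately have "of_nat 2 *s (jacobian_matrix ?N *v ?N) = 0"
    by (simp only:)
  then show "jacobian_matrix ?N *v ?N = 0"
    by (rule rat_algebra_polymap_scalar_eq_0[OF \<phi> zero_less_numeral])
qed

text \<open>
  The Euler operator \<open>\<E> E = JE \<cdot> X\<close> multiplies the part of degree \<open>k\<close> by \<open>k\<close>, so \<open>\<E> - d\<close> is injective
  in degrees above \<open>d\<close>.
\<close>

lemma euler_equation_imp_0:
  fixes \<phi> :: "rat \<Rightarrow> 'k::comm_ring_1" and E R :: "('n::finite, 'k) polymap"
  assumes \<phi>: "rat_algebra \<phi>" and start: "\<And>i. order_ge (d + 1) (E $ i)"
    and euler: "jacobian_matrix E *v polymap_id = of_nat d *s E + R"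
    and step: "\<And>k i. (\<And>i. order_ge (k + 1) (E $ i)) \<Longrightarrow> order_ge (k + 2) (R $ i)"
  shows "E = 0"
proof -
  have "\<forall>i. order_ge (d + k + 1) (E $ i)" for k
  proof (induction k)
    case 0
    show ?case
      using start by simp
  next
    case (Suc k)
    show ?case
    proof (intro allI order_geI)
      fix i and \<alpha> :: "'n \<Rightarrow>\<^sub>0 nat"
      assume \<alpha>: "mdeg \<alpha> < d + Suc k + 1"
      let ?e = "Poly_Mapping.lookup (E $ i) \<alpha>"
      show "?e = 0"
      proof (cases "mdeg \<alpha> \<le> d")
        case True
        then show ?thesis
          using order_geD[OF start, of \<alpha> i] by simp
      next
        case False
        \<comment> \<open>\<open>step\<close> puts \<open>R\<close> one order above
          \<open>E\<close>, so \<open>R\<close> does not reach the lowest degree in which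
          \<open>E\<close> may still be nonzero.\<close>
        have "Poly_Mapping.lookup (R $ i) \<alpha> = 0"
          using step[of "d + k" i] Suc \<alpha> order_geD[of "d + k + 2" "R $ i" \<alpha>] by simp
        moreover have "(\<Sum>j\<in>UNIV. partial j (E $ i) * var j) = of_nat d * E $ i + R $ i"
          using euler
          by (simp add: jacobian_matrix_def matrix_vector_mult_def polymap_id_def vec_eq_iff)
        ultimately have "of_nat (mdeg \<alpha>) * ?e = of_nat d * ?e"
          using lookup_euler[of "E $ i" \<alpha>] by (simp add: lookup_add lookup_of_nat_mult)
        \<comment> \<open>The eigenvalue |\<alpha>| of the Euler operator exceeds d, so the
          difference is a positive integer.\<close>
        then have "of_nat (mdeg \<alpha> - d) * ?e = 0"
          using False by (simp add: of_nat_diff left_diff_distrib)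
        then show ?thesis
          by (rule rat_algebra_of_nat_mult_eq_0[OF \<phi>, rotated]) (use False in simp)
      qed
    qed
  qed
  then have "order_ge k (E $ i)" for k i
    using order_ge_mono[of "d + k + 1" "E $ i" k] by simp
  then have "E $ i = 0" for i
    by (rule order_ge_all_imp_0)
  then show ?thesis
    by (simp add: vec_eq_iff)
qed

text \<open>
  The hypothesis on \<open>U\<close> is the Burgers equation above at \<open>t = 1\<close>, written without \<open>t\<close>: the coefficient
  of \<open>t\<^sup>m\<close> is homogeneous of degree \<open>(m + 1)(d - 1) + 1\<close>, so that \<open>(d - 1) t \<partial>/\<partial>t\<close> acts as \<open>\<E> - d\<close>.
\<close>

lemma burgers_imp_polymap_inverse:
  fixes \<phi> :: "rat \<Rightarrow> 'k::comm_ring_1" and H U :: "('n::finite, 'k) polymap"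
  assumes \<phi>: "rat_algebra \<phi>" and d: "d \<ge> 2" and hom: "\<forall>i. homogeneous d (H $ i)"
    and order_UH: "\<And>i. order_ge (d + 1) (U $ i - H $ i)"
    and burgers: "jacobian_matrix U *v polymap_id =
      of_nat d *s U + of_nat (d - 1) *s (jacobian_matrix U *v U)"
  shows "is_polymap_inverse (polymap_id - H) (polymap_id + U)"
proof -
  let ?F = "polymap_id - H" and ?G = "polymap_id + U"
  have order_H: "order_ge d (H $ i)" for i
    using hom by (simp add: order_ge_homogeneous)
  have order_U: "order_ge d (U $ i)" for i
    using order_ge_add[OF order_ge_mono[OF order_UH, of d i] order_H[of i]] by simp
  have order_id: "order_ge 1 (polymap_id $ i)" for i
    by (simp only: polymap_id_def vec_lambda_beta order_ge_var)
  have order_F: "order_ge 1 (?F $ i)" for i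
    using order_ge_diff[OF order_id order_ge_mono[OF order_H]] d by simp
  have order_G: "order_ge 1 (?G $ i)" for i
    using order_ge_add[OF order_id order_ge_mono[OF order_U]] d by simp

  \<comment> \<open>Here F(G) = X + U - H(G) = X - E, so the right inverse property amounts to E =
    0.\<close>
  define E where "E = polymap_compose H ?G - U"
  have "E = 0"
  proof (rule euler_equation_imp_0[OF \<phi>])
    fix i
    \<comment> \<open>\<open>?G\<close> differs from X in order d only, and 2 d - 1 \<ge> d + 1
      because d \<ge> 2.\<close>
    have "order_ge (d - 1 + d) (subst (H $ i) ?G - subst (H $ i) polymap_id)"
      by (rule congruent_subst[OF order_H order_G order_id]) (use order_U d in simp)
    then have "order_ge (d + 1) (subst (H $ i) ?G - H $ i)"
      unfolding subst_id by (rule order_ge_mono) (use d in simp)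
    from order_ge_diff[OF this order_UH[of i]] show "order_ge (d + 1) (E $ i)"
      by (simp add: E_def polymap_compose_def)
  next
    let ?A = "matrix_compose (jacobian_matrix H) ?G"
    have compose: "jacobian_matrix (polymap_compose H ?G) *v v = ?A *v (v + jacobian_matrix U *v v)" for v
      by (simp add: jacobian_matrix_compose jacobian_matrix_add jacobian_matrix_id
          matrix_vector_mul_assoc[symmetric] matrix_vector_mult_add_rdistrib)
    \<comment> \<open>Euler's identity JH X = d H, evaluated at \<open>?G\<close>.\<close>
    have euler: "?A *v ?G = of_nat d *s polymap_compose H ?G"
      using polymap_compose_matrix_vector_mult[of "jacobian_matrix H" polymap_id ?G]
      by (simp add: jacobian_matrix_euler[OF hom] polymap_compose_scalar)
    \<comment> \<open>The Burgers equation rewrites JU X. The bracket is JG U, so by the chain rule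
      it becomes J(H(G)) U in the next step.\<close>
    have split: "polymap_id + jacobian_matrix U *v polymap_id =
        ?G + of_nat (d - 1) *s (U + jacobian_matrix U *v U)"
      using d unfolding burgers by (simp add: vec_eq_iff of_nat_diff algebra_simps)
    have "jacobian_matrix (polymap_compose H ?G) *v polymap_id =
        of_nat d *s polymap_compose H ?G +
        of_nat (d - 1) *s (jacobian_matrix (polymap_compose H ?G) *v U)"
      unfolding compose split matrix_vector_right_distrib[of _ ?G] euler matrix_vector_mult_scalar ..
    then show "jacobian_matrix E *v polymap_id =
        of_nat d *s E + of_nat (d - 1) *s (jacobian_matrix E *v U)"
      unfolding E_def jacobian_matrix_diff matrix_vector_mult_diff_rdistrib burgers
      by (simp add: vec_eq_iff algebra_simps)
  next
    fix k i
    assume "\<And>i. order_ge (k + 1) (E $ i)"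
    then have "order_ge k (partial j (E $ i))" for j
      by (simp add: order_ge_partial)
    \<comment> \<open>Differentiation loses one order, but \<open>U\<close> has order at least 2, so
      one is gained overall.\<close>
    then have "order_ge (k + 2) (partial j (E $ i) * U $ j)" for j
      by (rule order_ge_mult) (rule order_ge_mono[OF order_U d])
    then have "order_ge (k + 2) ((jacobian_matrix E *v U) $ i)"
      by (simp add: jacobian_matrix_def matrix_vector_mult_def order_ge_sum)
    then show "order_ge (k + 2) ((of_nat (d - 1) *s (jacobian_matrix E *v U)) $ i)"
      using order_ge_mult[of 0 "of_nat (d - 1)" "k + 2"] by simp
  qed
  then have "polymap_compose ?F ?G = polymap_id"
    by (simp add: E_def polymap_compose_diff)

  moreover
  \<comment> \<open>Here G(F) = X - H + U(F) = X + E'. This error satisfies an Euler equation of its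
    own.\<close>
  define E' where "E' = polymap_compose U ?F - H"
  have "E' = 0"
  proof (rule euler_equation_imp_0[OF \<phi>])
    fix i
    have "order_ge (d - 1 + d) (subst (U $ i) ?F - subst (U $ i) polymap_id)"
      by (rule congruent_subst[OF order_U order_F order_id])
         (use order_H d in \<open>simp add: order_ge_def mps_of_poly_diff mps_order_ge_def\<close>)
    then have "order_ge (d + 1) (subst (U $ i) ?F - U $ i)"
      unfolding subst_id by (rule order_ge_mono) (use d in simp)
    from order_ge_add[OF this order_UH[of i]] show "order_ge (d + 1) (E' $ i)"
      by (simp add: E'_def polymap_compose_def)
  next
    let ?B = "matrix_compose (jacobian_matrix U) ?F"
    \<comment> \<open>The Burgers equation evaluated at \<open>?F\<close>.\<close>
    have burgers_F: "?B *v ?F =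
        of_nat d *s polymap_compose U ?F + of_nat (d - 1) *s (?B *v polymap_compose U ?F)"
      using arg_cong[OF burgers, of "\<lambda>P. polymap_compose P ?F"]
      by (simp add: polymap_compose_matrix_vector_mult polymap_compose_scalar polymap_compose_add)
    have "jacobian_matrix (polymap_compose U ?F) *v polymap_id = ?B *v (polymap_id - of_nat d *s H)"
      by (simp add: jacobian_matrix_compose jacobian_matrix_diff jacobian_matrix_id
          matrix_vector_mul_assoc[symmetric] matrix_vector_mult_diff_rdistrib jacobian_matrix_euler[OF hom])
    \<comment> \<open>Splitting off \<open>?F\<close> lets \<open>burgers_F\<close> apply; the rest
      pairs U(F) with -H and leaves E'.\<close>
    also have "polymap_id - of_nat d *s H = ?F - of_nat (d - 1) *s H"
      using d by (simp add: vec_eq_iff of_nat_diff algebra_simps)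
    also have "?B *v (?F - of_nat (d - 1) *s H) =
        of_nat d *s polymap_compose U ?F + of_nat (d - 1) *s (?B *v E')"
      unfolding matrix_vector_mult_diff_distrib[of _ ?F] burgers_F E'_def
      by (simp add: matrix_vector_mult_diff_distrib matrix_vector_mult_scalar vec_eq_iff algebra_simps)
    finally show "jacobian_matrix E' *v polymap_id = of_nat d *s E' + of_nat (d - 1) *s (?B *v E')"
      unfolding E'_def jacobian_matrix_diff matrix_vector_mult_diff_rdistrib
      by (simp add: jacobian_matrix_euler[OF hom] vec_eq_iff algebra_simps)
  next
    fix k i
    assume E': "\<And>i. order_ge (k + 1) (E' $ i)"
    \<comment> \<open>JU has order at least 1, and keeps it after substituting \<open>?F\<close>.
      This is the one order gained over E'.\<close>
    have "order_ge 1 (partial j (U $ i))" for j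
      using order_ge_mono[OF order_U d] by (simp add: order_ge_partial numeral_2_eq_2)
    then have order_B: "order_ge 1 (subst (partial j (U $ i)) ?F)" for j
      using order_F by (rule order_ge_subst)
    have "order_ge (k + 2) (subst (partial j (U $ i)) ?F * E' $ j)" for j
      using order_ge_mult[OF order_B E', of j j] by simp
    then have "order_ge (k + 2) ((matrix_compose (jacobian_matrix U) ?F *v E') $ i)"
      by (simp add: jacobian_matrix_def matrix_compose_def matrix_vector_mult_def order_ge_sum)
    then show "order_ge (k + 2) ((of_nat (d - 1) *s (matrix_compose (jacobian_matrix U) ?F *v E')) $ i)"
      using order_ge_mult[of 0 "of_nat (d - 1)" "k + 2"] by simp
  qed
  then have "polymap_compose ?G ?F = polymap_id"
    by (simp add: E'_def polymap_compose_add)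
  ultimately show ?thesis
    by (simp add: is_polymap_inverse_def)
qed

theorem theorem3p2:
  fixes \<phi> :: "rat \<Rightarrow> 'k::comm_ring_1"
    and H :: "('n::finite, 'k) polymap"
    and d :: nat
  assumes "rat_algebra \<phi>"
    and "d \<ge> 2"
    and "\<forall>i. homogeneous d (H $ i)"
    and "transpose (jacobian_matrix H) = jacobian_matrix H"
    and "jacobian_matrix H ** jacobian_matrix H ** jacobian_matrix H = 0"
  shows "polymap_invertible (polymap_id - H) \<and>
    polymap_inverse (polymap_id - H) = polymap_id + inverse_term d H 1 + inverse_term d H 2 \<and>
    polymap_degree (polymap_inverse (polymap_id - H)) \<le> 2 * d - 1"
proof -
  note hom_H = assms(3)
  define N where "N = jacobian_matrix H *v H"
  have "d > 0"
    using assms(2) by simp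
  note identities = symmetric_cube_zero_identities[OF assms(1) this assms(3-5), folded N_def]
  have deg: "d - 1 + d = 2 * d - 1"
    using assms(2) by simp
  have hom_N: "\<forall>i. homogeneous (2 * d - 1) (N $ i)"
    unfolding N_def jacobian_matrix_def matrix_vector_mult_def vec_lambda_beta deg[symmetric]
    using hom_H by (intro allI homogeneous_sum homogeneous_mult homogeneous_partial) simp_all
  \<comment> \<open>Of the four products, JH H is \<open>N\<close> and the other three vanish by the
    identities.\<close>
  have JU: "jacobian_matrix (H + N) *v (H + N) = N"
    by (simp add: jacobian_matrix_add matrix_vector_mult_add_rdistrib matrix_vector_right_distrib
        identities) (simp add: N_def)
  \<comment> \<open>Euler in degrees d and 2 d - 1 gives JU X = d H + (2 d - 1) N = d U + (d - 1) N
    with U = H + N.\<close>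
  have burgers: "jacobian_matrix (H + N) *v polymap_id =
      of_nat d *s (H + N) + of_nat (d - 1) *s (jacobian_matrix (H + N) *v (H + N))"
    unfolding JU unfolding jacobian_matrix_add matrix_vector_mult_add_rdistrib
      jacobian_matrix_euler[OF hom_H] jacobian_matrix_euler[OF hom_N]
    unfolding deg[symmetric] of_nat_add by (simp add: vec_eq_iff distrib_left distrib_right ac_simps)
  have order_H: "order_ge 2 (H $ i)" for i
    using order_ge_mono[OF order_ge_homogeneous[OF spec[OF hom_H]]] assms(2) .
  have order_N: "order_ge (d + 1) (N $ i)" for i
    using order_ge_mono[OF order_ge_homogeneous[OF spec[OF hom_N]]] assms(2) by simp
  have inverse: "is_polymap_inverse (polymap_id - H) (polymap_id + (H + N))"
    using burgers_imp_polymap_inverse[OF assms(1-3) _ burgers] order_N by simp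
  have order_U: "order_ge 2 ((H + N) $ i)" for i
    using order_ge_add[OF order_H order_ge_mono[OF order_N]] assms(2) by simp
  have formal: "formal_inverse (polymap_id - H) = mpsmap_of_polymap (polymap_id + (H + N))"
    using order_H order_U inverse by (rule formal_inverse_eq_polymap)
  \<comment> \<open>The degrees 1, d and 2 d - 1 are distinct as d \<ge> 2, and m (d - 1) + 1 is d
    for m = 1 and 2 d - 1 for m = 2. So the two inverse terms are read off as \<open>H\<close> and
    \<open>N\<close>.\<close>
  have "hom_part k (formal_inverse (polymap_id - H) $ i) =
      (if k = 1 then var i else 0) + (if k = d then H $ i else 0) +
      (if k = 2 * d - 1 then N $ i else 0)" for k i
    unfolding formal
    using hom_part_homogeneous[OF spec[OF hom_H]] hom_part_homogeneous[OF spec[OF hom_N]]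
    by (simp add: hom_part_homogeneous[OF homogeneous_var] mpsmap_of_polymap_def polymap_id_def
        mps_of_poly_add hom_part_add add.assoc)
  then have terms: "inverse_term d H 1 = H" "inverse_term d H 2 = N"
    using assms(2) by (auto simp: inverse_term_def vec_eq_iff)
  have inverse_eq: "polymap_inverse (polymap_id - H) = polymap_id + (H + N)"
    using inverse by (rule polymap_inverse_eqI)
  have "tdeg ((polymap_id + (H + N)) $ i) \<le> 2 * d - 1" for i
    using tdeg_homogeneous_le[OF spec[OF hom_H]] tdeg_homogeneous_le[OF spec[OF hom_N]] assms(2)
    by (simp add: tdeg_homogeneous_le[OF homogeneous_var] polymap_id_def tdeg_add_le)
  then have "polymap_degree (polymap_id + (H + N)) \<le> 2 * d - 1"
    by (simp add: polymap_degree_def)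
  then show ?thesis
    unfolding terms inverse_eq using inverse by (auto simp: polymap_invertible_def add.assoc)
qed

end
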